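(* Let $p\in(1,2)$ and let $B\subset\mathbb{R}^2$ be the open unit disc centered at the origin. For $u\in\mathbb{R}^2$ and $\kappa,\lambda,i,j\in\{1,2\}$ set $$A^{\kappa\lambda}_{ij}(u)=\delta_{\kappa\lambda}\delta_{ij}+\Big(\delta_{\kappa i}+\tfrac{2p}{2-p}\tfrac{u_iu_\kappa}{1+|u|^2}\Big)\Big(\delta_{\lambda j}+\tfrac{2p}{2-p}\tfrac{u_ju_\lambda}{1+|u|^2}\Big),$$ for $z,\bar z\in\mathbb{R}^{2\times2}$ let $A(u)(z,\bar z)=\sum_{\kappa,\lambda,i,j}A^{\kappa\lambda}_{ij}(u)z^\kappa_i\bar z^\lambda_j$ and $(A(u)z)^\lambda_j=\sum_{\kappa,i}A^{\kappa\lambda}_{ij}(u)z^\kappa_i$. Let $g\colon\mathbb{R}\to[0,1]$ be a symmetric smooth function with $\mathbf{1}_{\{0\}}\le g\le\mathbf{1}_{(-1,1)}$, let $m_g=(p-1)^{-1}\big(1+\sup_{s\in\mathbb{R}}\{|g'(s)|+2|g''(s)|s\}\big)$, and $a(u,z)=\big(g(|z|^2)+m_g\,A(u)(z,z)\big)^{\frac{p-2}{2}}A(u)z$. Let $u\colon B\to\mathbb{R}^2$, $u(x)=x/|x|$. Then $u\in W^{1,p}(B,\mathbb{R}^2)\cap L^\infty(B,\mathbb{R}^2)$ and $u$ is a weak solution of $\operatorname{div} a(u,Du)=0$ in $B$, i.e. $\int_B a(u,Du)\cdot D\varphi\,dx=0$ for all $\varphi\in C^\infty_c(B,\mathbb{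R}^2)$.
   Context: $\delta$ is the Kronecker delta, $\mathbf{1}_X$ the indicator function of $X$, $|z|$ the Euclidean norm on $\mathbb{R}^{2\times2}$. *)

theory Defs
  imports "HOL-Analysis.Analysis"
begin

definition kdelta :: "'a \<Rightarrow> 'a \<Rightarrow> real" where
  "kdelta a b = (if a = b then 1 else 0)"

definition partial :: "'n::finite \<Rightarrow> (real^'n \<Rightarrow> real) \<Rightarrow> real^'n \<Rightarrow> real" where
  "partial i f x = vector_derivative (\<lambda>t. f (x + t *\<^sub>R axis i 1)) (at 0)"

definition smooth_scalar :: "(real^'n::finite \<Rightarrow> real) \<Rightarrow> bool" where
  "smooth_scalar f \<longleftrightarrow> (\<forall>ds::'n list.
      (\<forall>x. foldr partial ds f differentiable (at x)) \<and> continuous_on UNIV (foldr partial ds f))"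

definition smooth_real :: "(real \<Rightarrow> real) \<Rightarrow> bool" where
  "smooth_real g \<longleftrightarrow> (\<forall>n x. (deriv ^^ n) g differentiable (at x))"

definition test_fun :: "(real^'n::finite) set \<Rightarrow> (real^'n \<Rightarrow> real^'m::finite) \<Rightarrow> bool" where
  "test_fun U \<phi> \<longleftrightarrow> (\<forall>k. smooth_scalar (\<lambda>x. \<phi> x $ k))
      \<and> compact (closure {x. \<phi> x \<noteq> 0}) \<and> closure {x. \<phi> x \<noteq> 0} \<subseteq> U"

definition grad :: "(real^'n::finite \<Rightarrow> real^'m::finite) \<Rightarrow> real^'n \<Rightarrow> real^'n^'m" where
  "grad \<phi> x = (\<chi> k i. partial i (\<lambda>y. \<phi> y $ k) x)"

definition Lp_on :: "real \<Rightarrow> (real^'n::finite) set \<Rightarrow> (real^'n \<Rightarrow> 'b::euclidean_space) \<Rightarrow> bool" where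
  "Lp_on p U f \<longleftrightarrow> set_borel_measurable lborel U f \<and> set_integrable lborel U (\<lambda>x. norm (f x) powr p)"

definition Linf_on :: "(real^'n::finite) set \<Rightarrow> (real^'n \<Rightarrow> 'b::euclidean_space) \<Rightarrow> bool" where
  "Linf_on U f \<longleftrightarrow> set_borel_measurable lborel U f \<and> (\<exists>C. AE x in lborel. x \<in> U \<longrightarrow> norm (f x) \<le> C)"

definition weak_grad :: "(real^'n::finite) set \<Rightarrow> (real^'n \<Rightarrow> real^'m::finite) \<Rightarrow> (real^'n \<Rightarrow> real^'n^'m) \<Rightarrow> bool" where
  "weak_grad U u Du \<longleftrightarrow> Lp_on 1 U u \<and> Lp_on 1 U Du \<and>
     (\<forall>\<phi>::real^'n \<Rightarrow> real. test_fun U (\<lambda>x. (\<chi> j::1. \<phi> x)) \<longrightarrow>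
        (\<forall>k i. (LINT x:U|lborel. u x $ k * partial i \<phi> x) = - (LINT x:U|lborel. Du x $ k $ i * \<phi> x)))"

definition W1p :: "real \<Rightarrow> (real^'n::finite) set \<Rightarrow> (real^'n \<Rightarrow> real^'m::finite) \<Rightarrow> bool" where
  "W1p p U u \<longleftrightarrow> Lp_on p U u \<and> (\<exists>Du. weak_grad U u Du \<and> Lp_on p U Du)"

definition Acoef :: "real \<Rightarrow> real^2 \<Rightarrow> 2 \<Rightarrow> 2 \<Rightarrow> 2 \<Rightarrow> 2 \<Rightarrow> real" where
  "Acoef p u \<kappa> l i j =
     kdelta \<kappa> l * kdelta i j +
     (kdelta \<kappa> i + (2*p/(2-p)) * (u$i * u$\<kappa>) / (1 + (norm u)^2)) *
     (kdelta l j + (2*p/(2-p)) * (u$j * u$l) / (1 + (norm u)^2))"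

definition Aform :: "real \<Rightarrow> real^2 \<Rightarrow> real^2^2 \<Rightarrow> real^2^2 \<Rightarrow> real" where
  "Aform p u z zb = (\<Sum>\<kappa>\<in>UNIV. \<Sum>l\<in>UNIV. \<Sum>i\<in>UNIV. \<Sum>j\<in>UNIV.
       Acoef p u \<kappa> l i j * z$\<kappa>$i * zb$l$j)"

definition Avec :: "real \<Rightarrow> real^2 \<Rightarrow> real^2^2 \<Rightarrow> real^2^2" where
  "Avec p u z = (\<chi> l j. \<Sum>\<kappa>\<in>UNIV. \<Sum>i\<in>UNIV. Acoef p u \<kappa> l i j * z$\<kappa>$i)"

definition m_g :: "real \<Rightarrow> (real \<Rightarrow> real) \<Rightarrow> real" where
  "m_g p g = (1 + (SUP s\<in>UNIV. \<bar>deriv g s\<bar> + 2 * \<bar>deriv (deriv g) s\<bar> * s)) / (p - 1)"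

definition afield :: "real \<Rightarrow> (real \<Rightarrow> real) \<Rightarrow> real^2 \<Rightarrow> real^2^2 \<Rightarrow> real^2^2" where
  "afield p g u z = (g ((norm z)^2) + m_g p g * Aform p u z z) powr ((p - 2) / 2) *\<^sub>R Avec p u z"

definition mdot :: "real^2^2 \<Rightarrow> real^2^2 \<Rightarrow> real" where
  "mdot z w = (\<Sum>l\<in>UNIV. \<Sum>j\<in>UNIV. z$l$j * w$l$j)"

end

theory Submission
  imports Defs
begin

text \<open>
  Write r = |x| and n = x/r. Off the origin, Du = (I - n n)/r, so |Du| = 1/r exceeds 1 in the disc and
  the term g(|Du|^2) vanishes. What remains of a(u, Du) is a constant multiple of
  r^(1-p) (I + (p-1)/(2-p) n n), which is divergence free away from 0 by direct computation.
  The singularity at 0 is invisible to the weak formulation: the functions involved and their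
  derivatives are bounded by multiples of r^(-q) with q < 2, hence integrable, and almost every line
  parallel to a coordinate axis misses the origin, so integration by parts holds by Fubini's theorem
  and the fundamental theorem of calculus on these lines. An arbitrary weak gradient agrees almost
  everywhere with the pointwise one, because products of one-dimensional smooth bumps approximate
  indicators of boxes.
\<close>

subsection \<open>Smooth bumps on boxes\<close>

text \<open>The coefficient 2p/(2-p) is tuned to a single number. The field r^(1-p) (I + b n n) has
  divergence r^(-p) ((1-p) + b (2-p)) n, which vanishes only for b = (p-1)/(2-p). Since |u| = 1
  gives 1 + |u|^2 = 2, the coefficient acts as h = p/(2-p), and A(u) Du = (2 I + (h-1) n n)/r with h
  - 1 = 2 b. Integrability is decided by the derivatives of this field, of size r^(-p); this is
  where p < 2, the dimension, enters. Working line by line avoids cutting out a small disc and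
  estimating a boundary term as its radius shrinks. The conclusion speaks of every weak gradient, so
  the explicit formula can be used only after uniqueness is known. It also claims integrability next
  to the value 0, because the integral of a non-integrable function is 0 by convention.\<close>

primrec times_differentiable :: "nat \<Rightarrow> (real \<Rightarrow> real) \<Rightarrow> bool" where
  "times_differentiable 0 f \<longleftrightarrow> (\<forall>x. f differentiable (at x))"
| "times_differentiable (Suc n) f \<longleftrightarrow> (\<forall>x. f differentiable (at x)) \<and> times_differentiable n (deriv f)"

text \<open>\<open>times_differentiable\<close> takes the first derivative and asks less of it,
  which suits inductions with the sum and product rules; this lemma returns to the iterates
  \<open>deriv ^^ n\<close> of \<open>smooth_real\<close>.\<close>

lemma smooth_realI:
  assumes "\<And>n. times_differentiable n f"
  shows "smooth_real f"
proof -
  have "(deriv ^^ n) f differentiable (at x)" if "times_differentiable n f" for n f x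
    using that by (induction n arbitrary: f) (auto simp: funpow_swap1)
  then show ?thesis
    using assms by (auto simp: smooth_real_def)
qed

lemma times_differentiable_differentiable: "times_differentiable n f \<Longrightarrow> f differentiable (at x)"
  by (cases n) auto

lemma times_differentiable_Suc_D: "times_differentiable (Suc n) f \<Longrightarrow> times_differentiable n f"
  by (induction n arbitrary: f) auto

lemma times_differentiable_add:
  "times_differentiable n f \<Longrightarrow> times_differentiable n g \<Longrightarrow> times_differentiable n (\<lambda>x. f x + g x)"
proof (induction n arbitrary: f g)
  case (Suc n)
  then have "deriv (\<lambda>x. f x + g x) = (\<lambda>x. deriv f x + deriv g x)"
    by (intro ext deriv_add) (simp_all add: field_differentiable_def real_differentiable_def)
  with Suc show ?case by auto
qed auto

lemma times_differentiable_mult: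
  "times_differentiable n f \<Longrightarrow> times_differentiable n g \<Longrightarrow> times_differentiable n (\<lambda>x. f x * g x)"
proof (induction n arbitrary: f g)
  case (Suc n)
  then have "deriv (\<lambda>x. f x * g x) = (\<lambda>x. f x * deriv g x + deriv f x * g x)"
    by (intro ext deriv_mult) (simp_all add: field_differentiable_def real_differentiable_def)
  moreover have "times_differentiable n f" "times_differentiable n g"
    using Suc.prems times_differentiable_Suc_D by blast+
  ultimately show ?case using Suc by (auto intro: times_differentiable_add)
qed auto

lemma times_differentiable_const: "times_differentiable n (\<lambda>x. c)"
  by (induction n arbitrary: c) auto

lemma times_differentiable_affine: "times_differentiable n f \<Longrightarrow> times_differentiable n (\<lambda>x. f (c * x + d))"
proof (induction n arbitrary: f)
  case 0
  then show ?case
    by (auto intro: differentiable_compose[of f, where g = "\<lambda>x. c * x + d"])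
next
  case (Suc n)
  have D: "((\<lambda>x. f (c * x + d)) has_real_derivative c * deriv f (c * x + d)) (at x)" for x
  proof -
    have "(f has_real_derivative deriv f (c * x + d)) (at (c * x + d))"
      using Suc.prems by (metis DERIV_imp_deriv times_differentiable_differentiable real_differentiableE)
    from DERIV_chain2[where g = "\<lambda>x. c * x + d" and Db = c, OF this]
    have "((\<lambda>x. f (c * x + d)) has_real_derivative deriv f (c * x + d) * c) (at x)"
      using DERIV_add[OF DERIV_cmult_Id[of c x] DERIV_const[of d]] by simp
    then show ?thesis by (simp add: mult.commute)
  qed
  then have "deriv (\<lambda>x. f (c * x + d)) = (\<lambda>x. c * deriv f (c * x + d))"
    using DERIV_imp_deriv by blast
  moreover have "(\<lambda>x. f (c * x + d)) differentiable (at x)" for x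
    using D real_differentiable_def by blast
  ultimately show ?case
    using Suc by (auto intro!: times_differentiable_mult times_differentiable_const)
qed

text \<open>The family is closed under differentiation, as exp (-1/s) times a polynomial in 1/s; its
  smoothness then follows from the limit at 0 alone.\<close>

definition flat :: "real poly \<Rightarrow> real \<Rightarrow> real" where
  "flat P s = (if s > 0 then poly P (1 / s) * exp (- 1 / s) else 0)"

lemma poly_times_exp_tendsto_0: "((\<lambda>y. poly P y * exp (- y)) \<longlongrightarrow> (0::real)) at_top"
proof -
  have "((\<lambda>y. \<Sum>i\<le>degree P. coeff P i * (y ^ i / exp y)) \<longlongrightarrow> (\<Sum>i\<le>degree P. coeff P i * 0)) at_top"
    by (intro tendsto_sum tendsto_mult tendsto_const tendsto_power_div_exp_0)
  moreover have "(\<lambda>y. poly P y * exp (- y)) = (\<lambda>y. \<Sum>i\<le>degree P. coeff P i * (y ^ i / exp y))"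
    by (auto simp: poly_altdef sum_distrib_right exp_minus divide_inverse mult.assoc)
  ultimately show ?thesis by simp
qed

lemma flat_tendsto_0: "(flat P \<longlongrightarrow> 0) (at 0)"
proof -
  have "(flat P \<longlongrightarrow> 0) (at_left 0)"
    by (rule tendsto_eventually) (auto simp: eventually_at_filter flat_def)
  moreover have "(flat P \<longlongrightarrow> 0) (at_right 0)"
  proof (rule Lim_transform_eventually)
    show "((\<lambda>s. poly P (inverse s) * exp (- inverse s)) \<longlongrightarrow> 0) (at_right 0)"
      by (rule filterlim_compose[OF poly_times_exp_tendsto_0 filterlim_inverse_at_top_right])
    show "\<forall>\<^sub>F s in at_right 0. poly P (inverse s) * exp (- inverse s) = flat P s"
      by (auto simp: eventually_at_filter flat_def divide_inverse)
  qed
  ultimately show ?thesis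
    by (simp add: filterlim_split_at)
qed

text \<open>\<open>[:0, 0, 1:]\<close> is the polynomial y^2: with y = 1/s the chain rule
  contributes the factor -y^2, and differentiating exp (-y) turns P into P' - P.\<close>

lemma flat_DERIV:
  "(flat P has_real_derivative flat ([:0, 0, 1:] * (P - pderiv P)) s) (at s)"
proof -
  consider "s > 0" | "s < 0" | "s = 0" by linarith
  then show ?thesis
  proof cases
    case 1
    have "((\<lambda>s. poly P (1 / s) * exp (- 1 / s)) has_real_derivative
        flat ([:0, 0, 1:] * (P - pderiv P)) s) (at s)"
    proof (rule DERIV_cong)
      have "((\<lambda>s. 1 / s) has_real_derivative - (1 / s\<^sup>2)) (at s)"
        using 1 by (auto intro!: derivative_eq_intros simp: power2_eq_square)
      then show "((\<lambda>s. poly P (1 / s) * exp (- 1 / s)) has_real_derivative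
          poly (pderiv P) (1 / s) * - (1 / s\<^sup>2) * exp (- 1 / s) + exp (- 1 / s) * (1 / s\<^sup>2) * poly P (1 / s)) (at s)"
        using 1 by (intro DERIV_mult DERIV_chain2[OF poly_DERIV])
          (auto intro!: derivative_eq_intros simp: power2_eq_square)
      show "poly (pderiv P) (1 / s) * - (1 / s\<^sup>2) * exp (- 1 / s) + exp (- 1 / s) * (1 / s\<^sup>2) * poly P (1 / s) =
          flat ([:0, 0, 1:] * (P - pderiv P)) s"
        using 1 by (simp add: flat_def power2_eq_square algebra_simps)
    qed
    then show ?thesis
      by (rule has_field_derivative_transform_within[where d = s]) (use 1 in \<open>auto simp: flat_def dist_real_def\<close>)
  next
    case 2
    have "((\<lambda>s. 0) has_real_derivative flat ([:0, 0, 1:] * (P - pderiv P)) s) (at s)"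
      using 2 by (auto simp: flat_def)
    then show ?thesis
      by (rule has_field_derivative_transform_within[where d = "-s"]) (use 2 in \<open>auto simp: flat_def dist_real_def\<close>)
  next
    case 3
    \<comment> \<open>Dividing by h multiplies the polynomial by y = 1/h, so the difference quotient
      at 0 is itself a member of the family and tends to 0.\<close>
    have "flat P h / h = flat ([:0, 1:] * P) h" for h
      by (auto simp: flat_def)
    then have "((\<lambda>h. (flat P (0 + h) - flat P 0) / h) \<longlongrightarrow> 0) (at 0)"
      using flat_tendsto_0[of "[:0, 1:] * P"] by (simp add: flat_def[of _ 0])
    then show ?thesis
      unfolding 3 DERIV_def by (simp add: flat_def[of _ 0])
  qed
qed

lemma times_differentiable_flat: "times_differentiable n (flat P)"
proof (induction n arbitrary: P)
  case 0
  then show ?case using flat_DERIV real_differentiable_def by auto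
next
  case (Suc n)
  have "deriv (flat P) = flat ([:0, 0, 1:] * (P - pderiv P))"
    using flat_DERIV DERIV_imp_deriv by blast
  with Suc show ?case using flat_DERIV real_differentiable_def by auto
qed

text \<open>The factor \<open>Suc n\<close> steepens the edges without moving them: exp (-1 / ((n+1)
  c)) tends to 1 for each c > 0, while the set where the bump is nonzero stays the open interval for
  all n.\<close>

definition bump :: "nat \<Rightarrow> real \<Rightarrow> real \<Rightarrow> real \<Rightarrow> real" where
  "bump n a b t = flat 1 (real (Suc n) * (t - a)) * flat 1 (real (Suc n) * (b - t))"

lemma smooth_bump: "smooth_real (bump n a b)"
proof (rule smooth_realI)
  fix k
  have "bump n a b = (\<lambda>t. flat 1 (real (Suc n) * t + (- real (Suc n) * a)) *
      flat 1 ((- real (Suc n)) * t + real (Suc n) * b))"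
    unfolding bump_def by (intro ext arg_cong2[where f = "(*)"] arg_cong[where f = "flat 1"]) (auto simp: algebra_simps)
  then show "times_differentiable k (bump n a b)"
    by (simp only:) (intro times_differentiable_mult times_differentiable_affine times_differentiable_flat)
qed

lemma bump_nonzero_iff: "bump n a b t \<noteq> 0 \<longleftrightarrow> a < t \<and> t < b"
  by (auto simp: bump_def flat_def zero_less_mult_iff)

lemma bump_bounds: "0 \<le> bump n a b t" "bump n a b t \<le> 1"
  by (auto simp: bump_def flat_def zero_less_mult_iff intro!: mult_le_one divide_nonneg_nonneg)

lemma bump_tendsto: "(\<lambda>n. bump n a b t) \<longlonglongrightarrow> indicator {a<..<b} t"
proof (cases "a < t \<and> t < b")
  case True
  have "(\<lambda>n. flat 1 (real (Suc n) * c)) \<longlonglongrightarrow> 1" if "c > 0" for c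
  proof -
    have "(\<lambda>n. exp (- (inverse c * inverse (real (Suc n))))) \<longlonglongrightarrow> exp (- (inverse c * 0))"
      by (intro tendsto_intros LIMSEQ_inverse_real_of_nat)
    then show ?thesis using that by (simp add: flat_def divide_inverse mult.commute zero_less_mult_iff)
  qed
  from tendsto_mult[OF this this, of "t - a" "b - t"] True show ?thesis
    by (simp add: bump_def)
next
  case False
  then have "bump n a b t = 0" for n using bump_nonzero_iff by blast
  with False show ?thesis by auto
qed

section \<open>Partial derivatives of products of one-variable functions\<close>

lemma has_vector_derivative_partial:
  assumes "f differentiable (at x)"
  shows "((\<lambda>t. f (x + t *\<^sub>R axis i 1)) has_vector_derivative partial i f x) (at 0)"
proof -
  have "(\<lambda>t. f (x + t *\<^sub>R axis i 1)) differentiable (at 0)"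
    using assms by (auto intro: differentiable_compose[of f, where g = "\<lambda>t. x + t *\<^sub>R axis i 1"])
  then show ?thesis
    by (simp add: partial_def vector_derivative_works)
qed

lemma partial_prod:
  fixes h :: "'n::finite \<Rightarrow> real \<Rightarrow> real"
  assumes "\<And>j x. h j differentiable (at x)"
  shows "partial i (\<lambda>x. \<Prod>j\<in>UNIV. h j (x $ j)) = (\<lambda>x. \<Prod>j\<in>UNIV. (if j = i then deriv (h j) else h j) (x $ j))"
proof
  fix x :: "real^'n"
  let ?C = "\<Prod>j\<in>UNIV - {i}. h j (x $ j)"
  have "(\<lambda>t. \<Prod>j\<in>UNIV. h j ((x + t *\<^sub>R axis i 1) $ j)) = (\<lambda>t. h i (x $ i + t) * ?C)"
  proof
    fix t
    have "(\<Prod>j\<in>UNIV. h j ((x + t *\<^sub>R axis i 1) $ j)) =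
        h i ((x + t *\<^sub>R axis i 1) $ i) * (\<Prod>j\<in>UNIV - {i}. h j ((x + t *\<^sub>R axis i 1) $ j))"
      by (rule prod.remove) auto
    also have "(\<Prod>j\<in>UNIV - {i}. h j ((x + t *\<^sub>R axis i 1) $ j)) = ?C"
      by (intro prod.cong) (auto simp: axis_def)
    finally show "(\<Prod>j\<in>UNIV. h j ((x + t *\<^sub>R axis i 1) $ j)) = h i (x $ i + t) * ?C"
      by (simp add: axis_def)
  qed
  moreover have "((\<lambda>t. h i (x $ i + t) * ?C) has_real_derivative deriv (h i) (x $ i) * ?C) (at 0)"
  proof -
    have "(h i has_real_derivative deriv (h i) (x $ i)) (at (x $ i + 0))"
      using assms by (metis DERIV_imp_deriv add.right_neutral real_differentiableE)
    from DERIV_chain2[where g = "\<lambda>t. x $ i + t" and Db = 1, OF this]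
    have "((\<lambda>t. h i (x $ i + t)) has_real_derivative deriv (h i) (x $ i)) (at 0)"
      by (simp add: DERIV_add[OF DERIV_const DERIV_ident, simplified])
    then show ?thesis by (rule DERIV_cmult_right)
  qed
  moreover have "deriv (h i) (x $ i) * ?C = (\<Prod>j\<in>UNIV. (if j = i then deriv (h j) else h j) (x $ j))"
    by (subst prod.remove[of UNIV i]) (auto intro!: prod.cong)
  ultimately show "partial i (\<lambda>x. \<Prod>j\<in>UNIV. h j (x $ j)) x = (\<Prod>j\<in>UNIV. (if j = i then deriv (h j) else h j) (x $ j))"
    by (simp add: partial_def vector_derivative_at has_real_derivative_iff_has_vector_derivative)
qed

text \<open>Products of one-variable functions are stable under \<open>partial\<close>: along a list
  \<open>ds\<close> of directions, factor j is differentiated as often as j occurs in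
  \<open>ds\<close>.\<close>

lemma smooth_scalar_prod:
  fixes h :: "'n::finite \<Rightarrow> real \<Rightarrow> real"
  assumes "\<And>j. smooth_real (h j)"
  shows "smooth_scalar (\<lambda>x. \<Prod>j\<in>UNIV. h j (x $ j))"
proof -
  have diff: "(\<lambda>x. \<Prod>j\<in>UNIV. (deriv ^^ c j) (h j) (x $ j)) differentiable (at x)" for c x
  proof -
    have "(\<lambda>x. (deriv ^^ c j) (h j) (x $ j)) differentiable (at x)" for j
      using assms by (intro differentiable_compose[of "(deriv ^^ c j) (h j)", where g = "\<lambda>x. x $ j"])
        (auto simp: smooth_real_def bounded_linear_imp_differentiable bounded_linear_vec_nth)
    then have "\<forall>j. \<exists>D. ((\<lambda>x. (deriv ^^ c j) (h j) (x $ j)) has_derivative D) (at x)"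
      by (simp add: differentiable_def)
    then obtain D where D: "((\<lambda>x. (deriv ^^ c j) (h j) (x $ j)) has_derivative D j) (at x)" for j
      by (auto dest!: choice)
    show ?thesis
      unfolding differentiable_def by (rule exI, rule has_derivative_prod, rule D)
  qed
  have "foldr partial ds (\<lambda>x. \<Prod>j\<in>UNIV. h j (x $ j)) =
      (\<lambda>x. \<Prod>j\<in>UNIV. (deriv ^^ count_list ds j) (h j) (x $ j))" for ds
  proof (induction ds)
    case (Cons i ds)
    have "foldr partial (i # ds) (\<lambda>x. \<Prod>j\<in>UNIV. h j (x $ j)) =
      partial i (\<lambda>x. \<Prod>j\<in>UNIV. (deriv ^^ count_list ds j) (h j) (x $ j))"
      using Cons by simp
    also have "\<dots> = (\<lambda>x. \<Prod>j\<in>UNIV. (if j = i then deriv ((deriv ^^ count_list ds j) (h j))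
        else (deriv ^^ count_list ds j) (h j)) (x $ j))"
      using assms by (intro partial_prod) (auto simp: smooth_real_def)
    also have "\<dots> = (\<lambda>x. \<Prod>j\<in>UNIV. (deriv ^^ count_list (i # ds) j) (h j) (x $ j))"
      by (intro ext prod.cong) auto
    finally show ?case .
  qed simp
  then show ?thesis
    unfolding smooth_scalar_def using diff
    by (simp add: differentiable_imp_continuous_on differentiable_on_def differentiable_at_withinI)
qed

definition box_bump :: "nat \<Rightarrow> real^'n \<Rightarrow> real^'n \<Rightarrow> real^'n::finite \<Rightarrow> real" where
  "box_bump n a b x = (\<Prod>j\<in>UNIV. bump n (a $ j) (b $ j) (x $ j))"

lemma box_bump_nonzero: "{x. box_bump n a b x \<noteq> 0} = box a b"
  by (auto simp: box_bump_def bump_nonzero_iff mem_box_cart)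

lemma box_bump_bounds: "0 \<le> box_bump n a b x" "box_bump n a b x \<le> 1"
  by (auto simp: box_bump_def intro!: prod_nonneg prod_le_1 bump_bounds)

lemma box_bump_tendsto: "(\<lambda>n. box_bump n a b x) \<longlonglongrightarrow> indicator (box a b) x"
proof -
  have "(\<lambda>n. box_bump n a b x) \<longlonglongrightarrow> (\<Prod>j\<in>UNIV. indicator {a$j<..<b$j} (x$j))"
    unfolding box_bump_def by (intro tendsto_prod bump_tendsto)
  also have "(\<Prod>j\<in>UNIV. indicator {a$j<..<b$j} (x$j)) = (indicator (box a b) x :: real)"
  proof (cases "x \<in> box a b")
    case True
    then show ?thesis by (auto simp: mem_box_cart intro!: prod.neutral)
  next
    case False
    then obtain j where "x$j \<notin> {a$j<..<b$j}" by (auto simp: mem_box_cart)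
    with False show ?thesis by (subst prod_zero[of UNIV]) (auto simp: indicator_def intro!: exI[of _ j])
  qed
  finally show ?thesis .
qed

lemma test_fun_scalar_iff:
  "test_fun U (\<lambda>x. (\<chi> j::1. f x)) \<longleftrightarrow> smooth_scalar f \<and> compact (closure {x. f x \<noteq> 0}) \<and> closure {x. f x \<noteq> 0} \<subseteq> U"
  by (simp add: test_fun_def vec_eq_iff)

lemma bounded_compact_support:
  fixes f :: "'a::real_normed_vector \<Rightarrow> real"
  assumes "continuous_on UNIV f" "compact (closure {x. f x \<noteq> 0})"
  obtains C where "\<And>x. \<bar>f x\<bar> \<le> C"
proof -
  have "bounded (f ` closure {x. f x \<noteq> 0})"
    using assms by (intro compact_imp_bounded compact_continuous_image) (auto intro: continuous_on_subset)
  then obtain C where C: "\<And>x. x \<in> closure {x. f x \<noteq> 0} \<Longrightarrow> \<bar>f x\<bar> \<le> C"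
    by (auto simp: bounded_iff)
  \<comment> \<open>\<open>C\<close> may be negative if the support is empty, and off the support
    the bound has to cover the value 0.\<close>
  have "\<bar>f x\<bar> \<le> max C 0" for x
    using C[of x] closure_subset[of "{x. f x \<noteq> 0}"] by (cases "f x = 0") fastforce+
  then show ?thesis by (rule that)
qed

lemma test_fun_box_bump:
  assumes "cbox a b \<subseteq> U"
  shows "test_fun U (\<lambda>x. (\<chi> j::1. box_bump n a b x))"
proof -
  have "closure (box a b) \<subseteq> cbox a b"
    by (intro closure_minimal box_subset_cbox closed_cbox)
  then show ?thesis
    unfolding test_fun_scalar_iff box_bump_nonzero
    using assms smooth_scalar_prod[of "\<lambda>j. bump n (a $ j) (b $ j)"]
    by (auto simp: smooth_bump box_bump_def[abs_def])
qed

subsection \<open>Uniqueness of weak gradients\<close>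

text \<open>A Dynkin argument: open boxes are stable under intersection and generate the Borel sets,
  and the sets over which f integrates to 0 are closed under complements and countable disjoint
  unions.\<close>

lemma AE_zero_if_box_integrals_zero:
  fixes f :: "'a::euclidean_space \<Rightarrow> real"
  assumes f: "integrable lborel f"
    and box: "\<And>a b. (LINT x:box a b|lborel. f x) = 0"
  shows "AE x in lborel. f x = 0"
proof (rule density_unique_real[where f' = "\<lambda>_. 0", simplified])
  show "integrable lborel f" by fact
  have set: "set_integrable lborel S f" if "S \<in> sets borel" for S
    using f that unfolding set_integrable_def by (intro integrable_mult_indicator) auto
  \<comment> \<open>The complement step needs the integral over the whole space, obtained by
    exhausting it with boxes.\<close>
  have UNIV: "(LINT x:UNIV|lborel. f x) = 0"
  proof -
    have "(\<lambda>n. LINT x:box (- real n *\<^sub>R One) (real n *\<^sub>R One)|lborel. f x) \<longlonglongrightarrow> (LINT x:(\<Union>n. box (- real n *\<^sub>R One) (real n *\<^sub>R One))|lborel. f x)"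
      by (intro set_integral_cont_up set) (auto simp: incseq_def subset_box)
    then show ?thesis
      using box by (simp add: UN_box_eq_UNIV[where 'a = 'a] LIMSEQ_const_iff)
  qed
  fix S :: "'a set"
  assume "S \<in> sets lborel"
  then have S: "S \<in> sigma_sets UNIV (range (\<lambda>(a, b). box a b))"
    by (simp add: borel_eq_box)
  have "Int_stable (range (\<lambda>(a, b). box a b :: 'a set))"
    by (auto simp: Int_stable_def box_Int_box)
  moreover have "range (\<lambda>(a, b). box a b :: 'a set) \<subseteq> Pow UNIV"
    by simp
  ultimately show "(LINT x:S|lborel. f x) = 0"
    using S
  proof (induction rule: sigma_sets_induct_disjoint)
    case (basic A)
    then show ?case using box by auto
  next
    case empty
    show ?case by (simp add: set_lebesgue_integral_def)
  next
    case (compl A)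
    then have "A \<in> sets borel" by (simp add: borel_eq_box)
    then have "(LINT x:A \<union> (UNIV - A)|lborel. f x) = (LINT x:A|lborel. f x) + (LINT x:UNIV - A|lborel. f x)"
      by (intro set_integral_Un set) auto
    with compl UNIV show ?case by simp
  next
    case (union A)
    then have "A i \<in> sets borel" for i by (auto simp: borel_eq_box)
    then have "(LINT x:(\<Union>i. A i)|lborel. f x) = (\<Sum>i. LINT x:A i|lborel. f x)"
      using union(1) by (intro lebesgue_integral_countable_add set) (auto simp: disjoint_family_on_def)
    with union show ?case by simp
  qed
qed

text \<open>The fundamental lemma of the calculus of variations. Since w is integrable over U,
  dominated convergence along the bumps gives zero integrals over boxes whose closed versions lie in
  U; the result is first local, on each such box.\<close>

lemma AE_zero_if_test_integrals_zero:
  fixes w :: "real^'n::finite \<Rightarrow> real"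
  assumes U: "open U" and w: "set_integrable lborel U w"
    and test: "\<And>\<phi>. test_fun U (\<lambda>x. (\<chi> j::1. \<phi> x)) \<Longrightarrow> (LINT x:U|lborel. w x * \<phi> x) = 0"
  shows "AE x in lborel. x \<in> U \<longrightarrow> w x = 0"
proof -
  have sub: "set_integrable lborel S w" if "S \<in> sets borel" "S \<subseteq> U" for S
    using set_integrable_subset[OF w] that by simp
  have box: "(LINT x:box a b|lborel. w x) = 0" if "cbox a b \<subseteq> U" for a b
  proof -
    have "(\<lambda>n. LINT x|lborel. (indicator U x * w x) * box_bump n a b x) \<longlonglongrightarrow> (LINT x|lborel. (indicator U x * w x) * indicator (box a b) x)"
    proof (rule integral_dominated_convergence[where w = "\<lambda>x. \<bar>indicator U x * w x\<bar>"])
      have [measurable]: "(\<lambda>x. indicator U x * w x) \<in> borel_measurable lborel"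
        using w by (auto simp: set_integrable_def)
      show "(\<lambda>x. (indicator U x * w x) * indicator (box a b) x) \<in> borel_measurable lborel"
        by measurable
      have "continuous_on UNIV (box_bump n a b)" for n
        using test_fun_box_bump[OF that, of n]
        by (auto simp: test_fun_scalar_iff smooth_scalar_def dest: spec[of _ "[]"])
      then have [measurable]: "box_bump n a b \<in> borel_measurable borel" for n
        by (rule borel_measurable_continuous_onI)
      show "(\<lambda>x. (indicator U x * w x) * box_bump n a b x) \<in> borel_measurable lborel" for n
        by measurable
      show "integrable lborel (\<lambda>x. \<bar>indicator U x * w x\<bar>)"
        using w by (auto simp: set_integrable_def)
      show "AE x in lborel. (\<lambda>n. (indicator U x * w x) * box_bump n a b x) \<longlonglongrightarrow> (indicator U x * w x) * indicator (box a b) x"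
        by (intro AE_I2 tendsto_intros box_bump_tendsto)
      show "AE x in lborel. norm ((indicator U x * w x) * box_bump n a b x) \<le> \<bar>indicator U x * w x\<bar>" for n
        using box_bump_bounds[of n a b] by (intro AE_I2) (auto simp: abs_mult mult_left_le indicator_def)
    qed
    moreover have "(LINT x|lborel. (indicator U x * w x) * box_bump n a b x) = 0" for n
      using test[OF test_fun_box_bump[OF that, of n]] by (simp add: set_lebesgue_integral_def mult.assoc)
    moreover have "(LINT x|lborel. (indicator U x * w x) * indicator (box a b) x) = (LINT x:box a b|lborel. w x)"
      unfolding set_lebesgue_integral_def using that box_subset_cbox[of a b]
      by (intro Bochner_Integration.integral_cong) (auto simp: indicator_def)
    ultimately show ?thesis
      using LIMSEQ_unique[OF tendsto_const, of 0] by fastforce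
  qed
  have Q: "AE x in lborel. x \<in> box c d \<longrightarrow> w x = 0" if "cbox c d \<subseteq> U" for c d
  proof -
    have "box c d \<subseteq> U" using that box_subset_cbox by blast
    have "AE x in lborel. indicator (box c d) x * w x = 0"
    proof (rule AE_zero_if_box_integrals_zero)
      show "integrable lborel (\<lambda>x. indicator (box c d) x * w x)"
        using sub[OF _ \<open>box c d \<subseteq> U\<close>] by (simp add: set_integrable_def)
      fix a b :: "real^'n"
      \<comment> \<open>The same corners describe the intersection of the open and of the closed
        boxes, so the closed one still lies in U and \<open>box\<close> applies.\<close>
      obtain e f where ef: "box a b \<inter> box c d = box e f" "cbox a b \<inter> cbox c d = cbox e f"
        using Int_interval[of a b c d] box_Int_box[of a b c d] by blast
      then have "(LINT x:box e f|lborel. w x) = 0"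
        using that by (intro box) auto
      moreover have "(LINT x:box a b|lborel. indicator (box c d) x * w x) = (LINT x:box e f|lborel. w x)"
        unfolding ef(1)[symmetric] set_lebesgue_integral_def
        by (intro Bochner_Integration.integral_cong) (auto simp: indicator_def)
      ultimately show "(LINT x:box a b|lborel. indicator (box c d) x * w x) = 0" by simp
    qed
    then show ?thesis by eventually_elim (auto simp: indicator_def split: if_splits)
  qed
  \<comment> \<open>The Lindelof property leaves countably many boxes, so the exceptional null sets
    can be united.\<close>
  define \<C> where "\<C> = {box c d |c d. cbox c d \<subseteq> U}"
  obtain \<D> where \<D>: "\<D> \<subseteq> \<C>" "countable \<D>" "\<Union>\<D> = \<Union>\<C>"
    by (rule Lindelof[of \<C>]) (auto simp: \<C>_def)
  have "U \<subseteq> \<Union>\<C>"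
  proof
    fix x assume "x \<in> U"
    with U obtain c d where "x \<in> box c d" "cbox c d \<subseteq> U"
      by (meson open_contains_cbox)
    then show "x \<in> \<Union>\<C>" by (auto simp: \<C>_def)
  qed
  moreover have "AE x in lborel. \<forall>X\<in>\<D>. x \<in> X \<longrightarrow> w x = 0"
    unfolding AE_ball_countable[OF \<D>(2)] using \<D>(1) Q unfolding \<C>_def by blast
  ultimately show ?thesis
    using \<D>(3) by (auto elim!: eventually_mono)
qed

lemma Lp_on_1_set_integrable:
  assumes "Lp_on 1 U F" "U \<in> sets borel"
  shows "set_integrable lborel U F"
proof -
  have "set_integrable lborel U (\<lambda>x. norm (F x))"
    using assms by (simp add: Lp_on_def)
  moreover have "set_borel_measurable lborel U F"
    using assms by (simp add: Lp_on_def)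
  ultimately show ?thesis
    by (rule set_integrable_bound) simp
qed

lemma weak_gradD:
  "weak_grad U u D \<Longrightarrow> test_fun U (\<lambda>x. (\<chi> j::1. \<phi> x)) \<Longrightarrow>
    (LINT x:U|lborel. u x $ k * partial i \<phi> x) = - (LINT x:U|lborel. D x $ k $ i * \<phi> x)"
  by (simp add: weak_grad_def)

text \<open>The left side of the defining identity involves only u, so D and E have equal integrals
  against each test function, and the fundamental lemma applies to each entry of D - E.\<close>

lemma weak_grad_unique:
  fixes u :: "real^'n::finite \<Rightarrow> real^'m::finite"
  assumes U: "open U" and D: "weak_grad U u D" and E: "weak_grad U u E"
  shows "AE x in lborel. x \<in> U \<longrightarrow> D x = E x"
proof -
  have int: "set_integrable lborel U (\<lambda>x. F x $ k $ i)" if "weak_grad U u F" for F k i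
  proof -
    have "set_integrable lborel U F"
      using that U by (auto simp: weak_grad_def intro!: Lp_on_1_set_integrable)
    moreover have "bounded_linear (\<lambda>z::real^'n^'m. z $ k $ i)"
      by (intro bounded_linear_compose[OF bounded_linear_vec_nth] bounded_linear_vec_nth)
    ultimately have "integrable lborel (\<lambda>x. (indicator U x *\<^sub>R F x) $ k $ i)"
      unfolding set_integrable_def by (rule integrable_bounded_linear[rotated])
    then show ?thesis by (simp add: set_integrable_def)
  qed
  have "AE x in lborel. x \<in> U \<longrightarrow> D x $ k $ i - E x $ k $ i = 0" for k i
  proof (rule AE_zero_if_test_integrals_zero[OF U])
    show "set_integrable lborel U (\<lambda>x. D x $ k $ i - E x $ k $ i)"
      by (intro set_integral_diff int D E)
    fix \<phi> :: "real^'n \<Rightarrow> real"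
    assume \<phi>: "test_fun U (\<lambda>x. (\<chi> j::1. \<phi> x))"
    \<comment> \<open>Splitting the integral of the difference requires each part to be integrable;
      this holds because a test function is bounded.\<close>
    have int\<phi>: "set_integrable lborel U (\<lambda>x. F x $ k $ i * \<phi> x)" if "weak_grad U u F" for F
    proof -
      have cont: "continuous_on UNIV \<phi>"
        using \<phi> by (auto simp: test_fun_scalar_iff smooth_scalar_def dest: spec[of _ "[]"])
      then have [measurable]: "\<phi> \<in> borel_measurable borel"
        by (rule borel_measurable_continuous_onI)
      obtain C where C: "\<And>x. \<bar>\<phi> x\<bar> \<le> C"
        using bounded_compact_support[OF cont] \<phi> by (auto simp: test_fun_scalar_iff)
      define W where "W x = indicator U x * F x $ k $ i" for x
      have W: "integrable lborel W"
        using int[OF that, of k i] by (simp add: set_integrable_def W_def[abs_def])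
      then have [measurable]: "W \<in> borel_measurable borel" by auto
      have "\<bar>\<phi> x * W x\<bar> \<le> \<bar>C * W x\<bar>" for x
        using order.trans[OF C abs_ge_self] by (auto simp: abs_mult intro: mult_right_mono)
      then have "integrable lborel (\<lambda>x. \<phi> x * W x)"
        by (intro Bochner_Integration.integrable_bound[OF integrable_mult_right[OF W, of C]]) auto
      then show ?thesis by (simp add: set_integrable_def W_def mult_ac)
    qed
    have "(LINT x:U|lborel. D x $ k $ i * \<phi> x) = (LINT x:U|lborel. E x $ k $ i * \<phi> x)"
      using weak_gradD[OF D \<phi>, of k i] weak_gradD[OF E \<phi>, of k i] by simp
    then show "(LINT x:U|lborel. (D x $ k $ i - E x $ k $ i) * \<phi> x) = 0"
      using int\<phi>[OF D] int\<phi>[OF E] by (simp add: left_diff_distrib set_integral_diff)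
  qed
  then have "AE x in lborel. \<forall>k i. x \<in> U \<longrightarrow> D x $ k $ i - E x $ k $ i = 0"
    unfolding AE_all_countable by blast
  then show ?thesis
    by eventually_elim (simp add: vec_eq_iff)
qed

subsection \<open>Integration by parts across the origin\<close>

lemma set_borel_measurableI:
  fixes f :: "'a::euclidean_space \<Rightarrow> 'b::euclidean_space"
  shows "f \<in> borel_measurable borel \<Longrightarrow> S \<in> sets borel \<Longrightarrow> set_borel_measurable lborel S f"
  unfolding set_borel_measurable_def
  by (intro borel_measurable_scaleR borel_measurable_indicator) auto

text \<open>Since |x1| |x2| is at most r^2, the function r^(-q) is dominated by |x1|^(-q/2) |x2|^(-q/2),
  an integrable product of one-variable functions. This fails on the axes, where the junk value
  0 powr s = 0 makes the product vanish, so the bound holds only almost everywhere.\<close>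

lemma set_integrable_norm_powr:
  fixes q :: real
  assumes q: "0 \<le> q" "q < 2"
  shows "set_integrable lborel (ball 0 1) (\<lambda>x::real^2. norm x powr - q)"
proof -
  define s where "s = q / 2"
  have s: "0 \<le> s" "s < 1" using q by (auto simp: s_def)
  define f :: "real \<Rightarrow> real" where "f y = indicator {-1..1} y * \<bar>y\<bar> powr - s" for y
  have f_nonneg: "0 \<le> f y" for y by (simp add: f_def)
  have [measurable]: "f \<in> borel_measurable borel" unfolding f_def by measurable
  have "((\<lambda>y. y powr - s) has_integral (1 / (1 - s))) {0..1}"
    using has_integral_powr_from_0[of "- s" 1] s by simp
  then have R: "((\<lambda>y. \<bar>y\<bar> powr - s) has_integral (1 / (1 - s))) {0..1}"
    by (rule has_integral_eq[rotated]) auto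
  then have "((\<lambda>y. \<bar>y\<bar> powr - s) has_integral (1 / (1 - s))) {-1..0}"
    using has_integral_reflect_real[THEN iffD2, OF R] by simp
  then have "((\<lambda>y. \<bar>y\<bar> powr - s) has_integral (1 / (1 - s) + 1 / (1 - s))) {-1..1}"
    by (rule has_integral_combine[rotated 2]) (use R in auto)
  then have f_int: "(\<integral>\<^sup>+y. ennreal (f y) \<partial>lborel) = ennreal (1 / (1 - s) + 1 / (1 - s))"
    unfolding f_def by (rule nn_integral_has_integral_lebesgue[rotated]) auto
  define g :: "real^2 \<Rightarrow> real" where "g x = (\<Prod>b\<in>Basis. f (x \<bullet> b))" for x
  have g: "integrable lborel g"
  proof (rule integrableI_nonneg)
    show "g \<in> borel_measurable lborel" unfolding g_def[abs_def] by measurable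
    show "AE x in lborel. 0 \<le> g x" by (auto simp: g_def intro!: prod_nonneg f_nonneg)
    have "(\<integral>\<^sup>+x. ennreal (g x) \<partial>lborel) = (\<integral>\<^sup>+x. (\<Prod>b\<in>Basis. ennreal (f (x \<bullet> b))) \<partial>(lborel::(real^2) measure))"
      by (simp add: g_def prod_ennreal f_nonneg)
    also have "\<dots> = (\<Prod>b\<in>(Basis::(real^2) set). \<integral>\<^sup>+y. ennreal (f y) \<partial>lborel)"
      by (rule nn_integral_lborel_prod) auto
    also have "\<dots> < \<infinity>"
      unfolding f_int by (simp add: ennreal_power[symmetric] power_less_top_ennreal)
    finally show "(\<integral>\<^sup>+x. ennreal (g x) \<partial>lborel) < \<infinity>" .
  qed
  have nz: "AE x::real^2 in lborel. x $ k \<noteq> 0" for k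
  proof (rule AE_I')
    have "{x::real^2. x $ k = 0} \<in> null_sets lebesgue"
      using negligible_standard_hyperplane_cart negligible_iff_null_sets by blast
    moreover have "{x::real^2. x $ k = 0} \<in> sets lborel"
      by (auto intro!: borel_closed closed_Collect_eq continuous_intros)
    ultimately show "{x::real^2. x $ k = 0} \<in> null_sets lborel"
      using null_sets_completion_iff by blast
  qed auto
  show ?thesis
  proof (rule set_integrable_bound)
    show "set_integrable lborel (ball 0 1) g"
      unfolding set_integrable_def using g by (intro integrable_mult_indicator) auto
    show "set_borel_measurable lborel (ball 0 1) (\<lambda>x::real^2. norm x powr - q)"
      by (intro set_borel_measurableI) auto
    show "AE x in lborel. x \<in> ball 0 1 \<longrightarrow> norm (norm x powr - q) \<le> norm (g x)"
      using nz[of 1] nz[of 2]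
    proof eventually_elim
      case (elim x)
      show ?case
      proof
        assume "x \<in> ball 0 1"
        then have "\<bar>x $ k\<bar> \<le> 1" for k using component_le_norm_cart[of x k] by simp
        then have g: "g x = (\<bar>x $ 1\<bar> * \<bar>x $ 2\<bar>) powr - s"
          by (auto simp: g_def f_def Basis_vec_def UNIV_2 inner_axis axis_eq_axis indicator_def abs_le_iff powr_mult)
        have "norm x powr - q = ((norm x)\<^sup>2) powr - s"
          using elim by (simp add: s_def powr_powr flip: powr_numeral)
        also have "\<dots> \<le> (\<bar>x $ 1\<bar> * \<bar>x $ 2\<bar>) powr - s"
        proof (rule powr_mono2')
          have "\<bar>x $ 1\<bar> * \<bar>x $ 2\<bar> \<le> norm x * norm x"
            by (intro mult_mono component_le_norm_cart) auto
          then show "\<bar>x $ 1\<bar> * \<bar>x $ 2\<bar> \<le> (norm x)\<^sup>2" by (simp add: power2_eq_square)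
        qed (use elim s in auto)
        finally show "norm (norm x powr - q) \<le> norm (g x)" by (simp add: g)
      qed
    qed
  qed
qed

section \<open>Fubini along a coordinate direction\<close>

lemma two_indices:
  obtains i' :: 2 where "UNIV = {i, i'}" "i \<noteq> i'"
proof (cases "i = 1")
  case True
  then show ?thesis using that[of 2] UNIV_2 by simp
next
  case False
  with exhaust_2[of i] have "i = 2" by blast
  then show ?thesis using that[of 1] UNIV_2 by (simp add: insert_commute)
qed

text \<open>Puts direction i into the first slot whichever index it is, so that one Fubini argument
  serves both partial derivatives.\<close>

definition axis_coords :: "2 \<Rightarrow> real \<times> real \<Rightarrow> real^2" where
  "axis_coords i = (\<lambda>(s, t). \<chi> j. if j = i then s else t)"

lemma axis_coords_measurable [measurable]: "axis_coords i \<in> borel_measurable (lborel \<Otimes>\<^sub>M lborel)"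
proof -
  have "continuous_on UNIV (axis_coords i)"
    unfolding axis_coords_def case_prod_unfold
    by (intro continuous_on_vec_lambda, rename_tac j, case_tac "j = i") (auto intro!: continuous_intros)
  then show ?thesis
    by (simp add: lborel_prod borel_measurable_continuous_onI)
qed

text \<open>Lebesgue measure is determined by its values on boxes, and the preimage of a box is a
  rectangle with the same side lengths.\<close>

lemma distr_axis_coords: "distr (lborel \<Otimes>\<^sub>M lborel) borel (axis_coords i) = lborel"
proof (rule lborel_eqI[symmetric])
  fix l u :: "real^2"
  assume lu: "\<And>b. b \<in> Basis \<Longrightarrow> l \<bullet> b \<le> u \<bullet> b"
  then have le: "l $ k \<le> u $ k" for k
    using lu[of "axis k 1"] by (auto simp: inner_axis)
  obtain i' where i': "UNIV = {i, i'}" "i \<noteq> i'"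
    by (rule two_indices)
  have all: "(\<forall>j. P j) \<longleftrightarrow> P i \<and> P i'" for P using i'(1) by auto
  have "emeasure (distr (lborel \<Otimes>\<^sub>M lborel) borel (axis_coords i)) (box l u) =
      emeasure (lborel \<Otimes>\<^sub>M lborel) (axis_coords i -` box l u \<inter> space (lborel \<Otimes>\<^sub>M lborel))"
    by (rule emeasure_distr) auto
  also have "axis_coords i -` box l u \<inter> space (lborel \<Otimes>\<^sub>M lborel) = {l $ i<..<u $ i} \<times> {l $ i'<..<u $ i'}"
    using i' by (auto simp: axis_coords_def mem_box_cart space_pair_measure all)
  also have "emeasure (lborel \<Otimes>\<^sub>M lborel) \<dots> = ennreal (u $ i - l $ i) * ennreal (u $ i' - l $ i')"
    using le by (simp add: lborel.emeasure_pair_measure_Times)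
  also have "\<dots> = ennreal (\<Prod>k\<in>UNIV. u $ k - l $ k)"
    unfolding i'(1) using i'(2) le by (simp add: ennreal_mult)
  also have "(\<Prod>k\<in>UNIV. u $ k - l $ k) = (\<Prod>b\<in>Basis. (u - l) \<bullet> b)"
    unfolding Basis_vec_def
    by (subst prod.UNION_disjoint) (auto simp: axis_eq_axis inner_axis)
  finally show "emeasure (distr (lborel \<Otimes>\<^sub>M lborel) borel (axis_coords i)) (box l u) = (\<Prod>b\<in>Basis. (u - l) \<bullet> b)" .
qed auto

text \<open>Here t is the coordinate transverse to direction i, and only the line t = 0 meets the
  singularity. Integrability of H justifies Fubini; how h grows near the origin never
  enters.\<close>

lemma integral_partial_eq_0:
  fixes h H :: "real^2 \<Rightarrow> real"
  assumes H: "integrable lborel H"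
    and deriv: "\<And>x. x \<noteq> 0 \<Longrightarrow> ((\<lambda>t. h (x + t *\<^sub>R axis i 1)) has_real_derivative H x) (at 0)"
    and cont: "continuous_on (- {0}) H"
    and supp: "\<And>x. norm x \<ge> 1 \<Longrightarrow> h x = 0" "\<And>x. norm x \<ge> 1 \<Longrightarrow> H x = 0"
  shows "(LINT x|lborel. H x) = 0"
proof -
  have H': "integrable (lborel \<Otimes>\<^sub>M lborel) (\<lambda>(s, t). H (axis_coords i (s, t)))"
    using integrable_distr[OF axis_coords_measurable, of i H] H by (simp add: distr_axis_coords case_prod_unfold)
  have line: "(LINT s|lborel. H (axis_coords i (s, t))) = 0" if "t \<noteq> 0" for t
  proof -
    define X where "X s = axis_coords i (s, t)" for s
    have nz: "X s \<noteq> 0" for s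
    proof -
      obtain k where "k \<noteq> i" using two_indices[of i] by metis
      then have "X s $ k \<noteq> 0" using that by (simp add: X_def axis_coords_def)
      then show ?thesis by auto
    qed
    have X: "X (s + r) = X s + r *\<^sub>R axis i 1" for s r
      by (auto simp: X_def axis_coords_def vec_eq_iff axis_def)
    have norm: "norm (X s) \<ge> \<bar>s\<bar>" for s
      using component_le_norm_cart[of "X s" i] by (simp add: X_def axis_coords_def)
    have D: "((\<lambda>s. h (X s)) has_real_derivative H (X s)) (at s)" for s
      using deriv[OF nz[of s]] DERIV_shift[of "\<lambda>s. h (X s)" "H (X s)" 0 s]
      by (simp add: add.commute flip: X)
    have "(LINT s|lborel. H (X s)) = (LINT s|lborel. indicator {-1..1} s *\<^sub>R H (X s))"
    proof (intro Bochner_Integration.integral_cong refl)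
      fix s :: real
      show "H (X s) = indicator {-1..1} s *\<^sub>R H (X s)"
      proof (cases "s \<in> {-1..1}")
        case False
        then have "norm (X s) \<ge> 1" using norm[of s] by auto
        with False show ?thesis by (simp add: supp)
      qed simp
    qed
    \<comment> \<open>At s = 1 and s = -1 the point has norm at least 1 whatever t is, so both
      boundary values vanish.\<close>
    also have "\<dots> = h (X 1) - h (X (- 1))"
    proof (rule integral_FTC_atLeastAtMost)
      show "continuous_on {-1..1} (\<lambda>s. H (X s))"
      proof (rule continuous_on_compose2[OF cont])
        have "continuous_on {-1..1} (\<lambda>s. X 0 + s *\<^sub>R axis i 1)"
          by (intro continuous_intros)
        then show "continuous_on {-1..1} X"
          using X[of 0] by (simp flip: X)
      qed (use nz in auto)
    qed (use D in \<open>auto simp: has_real_derivative_iff_has_vector_derivative[symmetric] intro: DERIV_subset\<close>)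
    also have "\<dots> = 0" using norm[of 1] norm[of "- 1"] by (simp add: supp)
    finally show ?thesis by (simp add: X_def)
  qed
  have "(LINT x|lborel. H x) = (LINT x|distr (lborel \<Otimes>\<^sub>M lborel) borel (axis_coords i). H x)"
    by (simp add: distr_axis_coords)
  also have "\<dots> = (LINT z|(lborel \<Otimes>\<^sub>M lborel). H (axis_coords i z))"
    using H by (intro integral_distr) auto
  also have "\<dots> = (LINT t|lborel. LINT s|lborel. H (axis_coords i (s, t)))"
    using lborel_pair.integral_snd[OF H'] by (simp add: case_prod_unfold)
  also have "\<dots> = 0"
    using AE_lborel_singleton[of 0] by (intro integral_eq_zero_AE) (auto elim!: eventually_mono intro: line)
  finally show ?thesis .
qed

section \<open>Test functions and integration by parts in the punctured disc\<close>

lemma partial_eq_0_outside_support: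
  assumes "x \<notin> closure {x. f x \<noteq> 0}"
  shows "partial i f x = 0"
proof -
  let ?S = "(\<lambda>t. x + t *\<^sub>R axis i 1) -` (- closure {x. f x \<noteq> 0})"
  have "open ?S"
    by (intro open_vimage) (auto intro!: continuous_intros)
  moreover have "f (x + t *\<^sub>R axis i 1) = 0" if "t \<in> ?S" for t
    using that closure_subset[of "{x. f x \<noteq> 0}"] by auto
  ultimately have "((\<lambda>t. f (x + t *\<^sub>R axis i 1)) has_vector_derivative 0) (at 0)"
    using assms by (intro has_vector_derivative_transform_within_open[OF has_vector_derivative_const, of ?S]) auto
  then show ?thesis by (simp add: partial_def vector_derivative_at)
qed

lemma test_fun_facts:
  fixes \<phi> :: "real^'n::finite \<Rightarrow> real"
  assumes "test_fun U (\<lambda>x. (\<chi> j::1. \<phi> x))"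
  shows "continuous_on UNIV \<phi>" "continuous_on UNIV (partial i \<phi>)"
    "x \<notin> U \<Longrightarrow> \<phi> x = 0" "x \<notin> U \<Longrightarrow> partial i \<phi> x = 0"
    "\<exists>C. \<forall>x. \<bar>\<phi> x\<bar> \<le> C" "\<exists>C. \<forall>x. \<bar>partial i \<phi> x\<bar> \<le> C"
    "((\<lambda>t. \<phi> (x + t *\<^sub>R axis i 1)) has_real_derivative partial i \<phi> x) (at 0)"
proof -
  let ?K = "closure {x. \<phi> x \<noteq> 0}"
  have K: "compact ?K" "?K \<subseteq> U" and smooth: "smooth_scalar \<phi>"
    using assms by (auto simp: test_fun_scalar_iff)
  show 1: "continuous_on UNIV \<phi>" and 2: "continuous_on UNIV (partial i \<phi>)"
    using smooth[unfolded smooth_scalar_def, THEN spec, of "[]"] smooth[unfolded smooth_scalar_def, THEN spec, of "[i]"]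
    by simp_all
  show "\<phi> x = 0" "partial i \<phi> x = 0" if "x \<notin> U"
    using that K(2) closure_subset[of "{x. \<phi> x \<noteq> 0}"] partial_eq_0_outside_support[of x \<phi>] by auto
  show "\<exists>C. \<forall>x. \<bar>\<phi> x\<bar> \<le> C"
    using bounded_compact_support[OF 1 K(1)] by blast
  have "closure {x. partial i \<phi> x \<noteq> 0} \<subseteq> ?K"
    using partial_eq_0_outside_support[of _ \<phi> i] by (intro closure_minimal) auto
  then have "compact (closure {x. partial i \<phi> x \<noteq> 0})"
    using K(1) by (meson closed_closure compact_closure compact_imp_bounded bounded_subset closure_minimal compact_eq_bounded_closed)
  then show "\<exists>C. \<forall>x. \<bar>partial i \<phi> x\<bar> \<le> C"
    using bounded_compact_support[OF 2] by blast
  show "((\<lambda>t. \<phi> (x + t *\<^sub>R axis i 1)) has_real_derivative partial i \<phi> x) (at 0)"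
    using smooth[unfolded smooth_scalar_def, THEN spec, of "[]"]
    by (simp add: has_vector_derivative_partial has_real_derivative_iff_has_vector_derivative)
qed

lemma set_integrable_singular_times_bounded:
  fixes F \<psi> :: "real^2 \<Rightarrow> real"
  assumes q: "0 \<le> q" "q < 2" and [measurable]: "F \<in> borel_measurable borel" "\<psi> \<in> borel_measurable borel"
    and F: "\<And>x. x \<in> ball 0 1 \<Longrightarrow> x \<noteq> 0 \<Longrightarrow> \<bar>F x\<bar> \<le> C * norm x powr - q"
    and \<psi>: "\<And>x. \<bar>\<psi> x\<bar> \<le> K"
  shows "set_integrable lborel (ball 0 1) (\<lambda>x. F x * \<psi> x)"
proof (rule set_integrable_bound)
  show "set_integrable lborel (ball 0 1) (\<lambda>x::real^2. (C * K) * norm x powr - q)"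
    by (intro set_integrable_mult_right set_integrable_norm_powr q)
  show "set_borel_measurable lborel (ball 0 1) (\<lambda>x. F x * \<psi> x)"
    by (intro set_borel_measurableI borel_measurable_times assms) auto
  show "AE x in lborel. x \<in> ball 0 1 \<longrightarrow> norm (F x * \<psi> x) \<le> norm (C * K * norm x powr - q)"
    using AE_lborel_singleton[of 0]
  proof eventually_elim
    case (elim x)
    show ?case
    proof
      assume "x \<in> ball 0 1"
      then have "\<bar>F x\<bar> * \<bar>\<psi> x\<bar> \<le> (C * norm x powr - q) * K"
        using F[of x] elim by (intro mult_mono \<psi>) auto
      then show "norm (F x * \<psi> x) \<le> norm (C * K * norm x powr - q)"
        by (simp add: abs_mult[symmetric] mult_ac)
    qed
  qed
qed

text \<open>By the product rule the claim is that the derivative of F times the test function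
  integrates to 0. A single exponent q serves both F and G, since inside the disc a milder
  singularity is dominated by a stronger one.\<close>

lemma integration_by_parts_punctured:
  fixes F G \<phi> :: "real^2 \<Rightarrow> real"
  assumes q: "0 \<le> q" "q < 2" and meas: "F \<in> borel_measurable borel" "G \<in> borel_measurable borel"
    and cont: "continuous_on (- {0}) F" "continuous_on (- {0}) G"
    and deriv: "\<And>x. x \<noteq> 0 \<Longrightarrow> ((\<lambda>t. F (x + t *\<^sub>R axis i 1)) has_real_derivative G x) (at 0)"
    and F: "\<And>x. x \<in> ball 0 1 \<Longrightarrow> x \<noteq> 0 \<Longrightarrow> \<bar>F x\<bar> \<le> C * norm x powr - q"
    and G: "\<And>x. x \<in> ball 0 1 \<Longrightarrow> x \<noteq> 0 \<Longrightarrow> \<bar>G x\<bar> \<le> C * norm x powr - q"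
    and \<phi>: "test_fun (ball 0 1) (\<lambda>x. (\<chi> j::1. \<phi> x))"
  shows "set_integrable lborel (ball 0 1) (\<lambda>x. F x * partial i \<phi> x)" (is ?A)
    and "set_integrable lborel (ball 0 1) (\<lambda>x. G x * \<phi> x)" (is ?B)
    and "(LINT x:ball 0 1|lborel. F x * partial i \<phi> x) = - (LINT x:ball 0 1|lborel. G x * \<phi> x)"
proof -
  note facts = test_fun_facts[OF \<phi>]
  obtain K L where K: "\<And>x. \<bar>\<phi> x\<bar> \<le> K" and L: "\<And>x. \<bar>partial i \<phi> x\<bar> \<le> L"
    using facts(5) facts(6)[of i] by blast
  show A: ?A
    by (rule set_integrable_singular_times_bounded[OF q meas(1) _ F L])
      (auto intro: borel_measurable_continuous_onI facts)
  show B: ?B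
    by (rule set_integrable_singular_times_bounded[OF q meas(2) _ G K])
      (auto intro: borel_measurable_continuous_onI facts)
  have ball: "(\<lambda>x. indicator (ball 0 1) x *\<^sub>R (F x * partial i \<phi> x + G x * \<phi> x)) = (\<lambda>x. F x * partial i \<phi> x + G x * \<phi> x)"
    by (rule ext, rename_tac x, case_tac "x \<in> ball 0 1") (simp_all add: facts(3,4))
  have "(LINT x|lborel. F x * partial i \<phi> x + G x * \<phi> x) = 0"
  proof (rule integral_partial_eq_0[where h = "\<lambda>x. F x * \<phi> x" and i = i])
    show "integrable lborel (\<lambda>x. F x * partial i \<phi> x + G x * \<phi> x)"
      using set_integral_add(1)[OF A B] unfolding set_integrable_def ball .
    show "((\<lambda>t. F (x + t *\<^sub>R axis i 1) * \<phi> (x + t *\<^sub>R axis i 1)) has_real_derivative F x * partial i \<phi> x + G x * \<phi> x) (at 0)"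
      if "x \<noteq> 0" for x
      using DERIV_mult[OF deriv[OF that] facts(7)[of x i]] by (simp add: add.commute mult.commute)
    show "continuous_on (- {0}) (\<lambda>x. F x * partial i \<phi> x + G x * \<phi> x)"
      by (intro continuous_intros cont continuous_on_subset[OF facts(1)] continuous_on_subset[OF facts(2)]) auto
  qed (auto simp: facts(3,4))
  then have "(LINT x:ball 0 1|lborel. F x * partial i \<phi> x + G x * \<phi> x) = 0"
    unfolding set_lebesgue_integral_def ball .
  then show "(LINT x:ball 0 1|lborel. F x * partial i \<phi> x) = - (LINT x:ball 0 1|lborel. G x * \<phi> x)"
    using set_integral_add(2)[OF A B] by simp
qed

subsection \<open>The divergence-free field\<close>

lemma power2_norm_2: "(norm (x::real^2))\<^sup>2 = (x $ 1)\<^sup>2 + (x $ 2)\<^sup>2"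
  by (simp add: norm_vec_def L2_set_def sum_2)

lemma component_along_axis: "(x + t *\<^sub>R axis i 1) $ k = x $ k + t * kdelta k i"
  by (simp add: axis_def kdelta_def)

lemma DERIV_component_along_axis:
  "((\<lambda>t. (x + t *\<^sub>R axis i 1) $ k) has_real_derivative kdelta k i) (at 0)"
  unfolding component_along_axis by (auto intro!: derivative_eq_intros)

text \<open>Along the line the squared norm is a quadratic polynomial in t, so the norm is rewritten
  as a power of its square before differentiating.\<close>

lemma DERIV_norm_powr_along_axis:
  fixes x :: "real^'n::finite"
  assumes "x \<noteq> 0"
  shows "((\<lambda>t. norm (x + t *\<^sub>R axis i 1) powr s) has_real_derivative s * x $ i * norm x powr (s - 2)) (at 0)"
proof -
  have sq: "(norm (x + t *\<^sub>R axis i 1))\<^sup>2 = (norm x)\<^sup>2 + 2 * t * x $ i + t\<^sup>2" for t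
    unfolding power2_norm_eq_inner
    by (simp add: inner_add_left inner_add_right inner_axis inner_axis' power2_eq_square algebra_simps)
  have pow: "norm y powr r = ((norm y)\<^sup>2) powr (r / 2)" for r and y :: "real^'n"
    by (cases "y = 0") (simp_all add: powr_powr flip: powr_numeral)
  have "((\<lambda>t. (norm x)\<^sup>2 + 2 * t * x $ i + t\<^sup>2) has_real_derivative 2 * x $ i) (at 0)"
    by (auto intro!: derivative_eq_intros)
  from DERIV_fun_powr[OF this, of "s / 2"] assms show ?thesis
    unfolding pow[of "x + _ *\<^sub>R _"] sq pow[of x]
    by (simp add: mult_ac diff_divide_distrib)
qed

text \<open>Trades one coordinate for one power of r. The factor y may contain further coordinates,
  so the rule can be applied repeatedly; with 0 powr s = 0 it also covers the origin.\<close>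

lemma component_mult_norm_powr_le:
  fixes x :: "real^'n::finite"
  assumes "\<bar>y\<bar> * norm x powr (s + 1) \<le> B"
  shows "\<bar>y * x $ k * norm x powr s\<bar> \<le> B"
proof -
  have "\<bar>x $ k\<bar> * norm x powr s \<le> norm x * norm x powr s"
    by (intro mult_right_mono component_le_norm_cart) auto
  also have "\<dots> = norm x powr (s + 1)"
    by (simp add: powr_mult_base add.commute)
  finally have "\<bar>y\<bar> * (\<bar>x $ k\<bar> * norm x powr s) \<le> \<bar>y\<bar> * norm x powr (s + 1)"
    by (intro mult_left_mono) auto
  with assms show ?thesis by (simp add: abs_mult mult_ac)
qed

lemma borel_measurable_vec_lambda:
  fixes f :: "'n::finite \<Rightarrow> 'a \<Rightarrow> 'b::euclidean_space"
  assumes "\<And>k. f k \<in> borel_measurable M"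
  shows "(\<lambda>x. \<chi> k. f k x) \<in> borel_measurable M"
  unfolding borel_measurable_euclidean_space[of "\<lambda>x. \<chi> k. f k x"]
  using assms by (auto simp: Basis_vec_def inner_axis intro!: borel_measurable_inner)

text \<open>The gradient of x/|x| and, up to a constant factor, the field a(u, Du); the powers of r take the
  value 0 at the origin.\<close>

definition sgn_grad :: "real^2 \<Rightarrow> real^2^2" where
  "sgn_grad x = (\<chi> k i. kdelta k i * norm x powr - 1 - x $ k * x $ i * norm x powr - 3)"

definition flux :: "real \<Rightarrow> 2 \<Rightarrow> 2 \<Rightarrow> real^2 \<Rightarrow> real" where
  "flux p l j x = kdelta l j * norm x powr (1 - p) +
     (p - 1) / (2 - p) * (x $ l * x $ j * norm x powr (- 1 - p))"

definition flux_deriv :: "real \<Rightarrow> 2 \<Rightarrow> 2 \<Rightarrow> real^2 \<Rightarrow> real" where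
  "flux_deriv p l j x = kdelta l j * ((1 - p) * x $ j * norm x powr (- 1 - p)) +
     (p - 1) / (2 - p) * ((kdelta l j * x $ j + x $ l) * norm x powr (- 1 - p)
       + x $ l * x $ j * ((- 1 - p) * x $ j * norm x powr (- 3 - p)))"

lemma DERIV_flux:
  assumes "x \<noteq> 0"
  shows "((\<lambda>t. flux p l j (x + t *\<^sub>R axis j 1)) has_real_derivative flux_deriv p l j x) (at 0)"
proof -
  note d = DERIV_norm_powr_along_axis[OF assms, of j] DERIV_component_along_axis[of x j]
  have one: "kdelta j j = 1" "- p - 3 = - 3 - p" by (simp_all add: kdelta_def)
  show ?thesis
    unfolding flux_def
    by (rule DERIV_cong, (rule DERIV_add DERIV_cmult DERIV_mult d)+)
      (simp add: flux_deriv_def one algebra_simps)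
qed

text \<open>The sum over j of the derivatives of x_l x_j r^s is (3 + s) x_l r^s in the plane. For s
  = -1-p this gives the factor 2-p, which the chosen coefficient balances against 1-p.\<close>

lemma flux_divergence_free:
  assumes p: "p < 2" and x: "x \<noteq> 0"
  shows "(\<Sum>j\<in>UNIV. flux_deriv p l j x) = 0"
proof -
  define b where "b = (p - 1) / (2 - p)"
  have b: "b * (2 - p) = p - 1" using p by (simp add: b_def)
  define N where "N = norm x powr (- 3 - p)"
  have sq: "(x $ 1)\<^sup>2 + (x $ 2)\<^sup>2 = (norm x)\<^sup>2"
    by (rule power2_norm_2[symmetric])
  \<comment> \<open>Expressing every power of r through \<open>N\<close> and the squared coordinates
    leaves a polynomial identity.\<close>
  have "norm x powr (- 1 - p) = norm x powr (2 + (- 3 - p))" by simp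
  also have "\<dots> = ((x $ 1)\<^sup>2 + (x $ 2)\<^sup>2) * N"
    using x unfolding powr_add N_def sq by (simp add: powr_numeral)
  finally have N: "norm x powr (- 1 - p) = ((x $ 1)\<^sup>2 + (x $ 2)\<^sup>2) * N" .
  have "(\<Sum>j\<in>UNIV. flux_deriv p l j x) =
      x $ l * ((x $ 1)\<^sup>2 + (x $ 2)\<^sup>2) * N * ((1 - p) + b * (2 - p))"
    unfolding flux_deriv_def b_def[symmetric] N_def[symmetric] N sum_2
    using exhaust_2[of l] by (auto simp: kdelta_def power2_eq_square algebra_simps)
  then show ?thesis by (simp add: b)
qed

section \<open>The field evaluated at the gradient of x/|x|\<close>

lemma Avec_component:
  "Avec p u z $ l $ j = z $ l $ j +
     (kdelta l j + (2*p/(2-p)) * (u$j * u$l) / (1 + (norm u)^2)) *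
     (\<Sum>\<kappa>\<in>UNIV. \<Sum>i\<in>UNIV. (kdelta \<kappa> i + (2*p/(2-p)) * (u$i * u$\<kappa>) / (1 + (norm u)^2)) * z $ \<kappa> $ i)"
proof -
  \<comment> \<open>Both factors in the second summand of \<open>Acoef\<close> are entries of this
    one matrix, so A(u) is the identity plus the rank-one map z -> (M . z) M.\<close>
  define M where "M a b = kdelta a b + (2*p/(2-p)) * (u$b * u$a) / (1 + (norm u)^2)" for a b
  show ?thesis
    using exhaust_2[of l] exhaust_2[of j]
    unfolding Avec_def Acoef_def M_def[symmetric] by (auto simp: sum_2 kdelta_def algebra_simps)
qed

lemma Aform_eq_mdot: "Aform p u z w = mdot (Avec p u z) w"
  unfolding Aform_def mdot_def Avec_def by (simp add: sum_2 algebra_simps)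

text \<open>Once g drops out, A(z,z) = 2/r^2 makes the scalar factor a constant times r^(2-p), and
  the 1/r in A z lowers the exponent to 1-p.\<close>

lemma afield_sgn_grad:
  fixes x :: "real^2"
  assumes p: "1 < p" "p < 2" and x: "x \<noteq> 0" "norm x < 1"
    and g: "\<And>s. s \<ge> 1 \<Longrightarrow> g s = 0"
  shows "afield p g (inverse (norm x) *\<^sub>R x) (sgn_grad x) $ l $ j =
      2 * (2 * m_g p g) powr ((p - 2) / 2) * flux p l j x"
proof -
  define r where "r = norm x"
  have r: "0 < r" "r < 1" using x by (auto simp: r_def)
  define n where "n = inverse r *\<^sub>R x"
  define z where "z = sgn_grad x"
  define h where "h = p / (2 - p)"
  have xn: "x $ k = r * n $ k" for k using r by (simp add: n_def)
  have norm_n: "norm n = 1" using r by (simp add: n_def r_def)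
  have n: "(n $ 1)\<^sup>2 + (n $ 2)\<^sup>2 = 1"
    using norm_n power2_norm_2[of n] by simp
  have rp: "r powr - 1 = 1 / r" "r powr - 3 = 1 / r ^ 3"
    using r by (simp_all add: powr_minus divide_inverse powr_numeral)
  have z: "z $ k $ i = (kdelta k i - n $ k * n $ i) / r" for k i
    unfolding z_def sgn_grad_def r_def[symmetric] using r
    by (simp add: rp xn field_simps power3_eq_cube)
  have coef: "(2*p/(2-p)) * (n$i * n$k) / (1 + (norm n)^2) = h * (n $ i * n $ k)" for i k
    using p by (simp add: norm_n h_def divide_simps)
  have S: "(\<Sum>\<kappa>\<in>UNIV. \<Sum>i\<in>UNIV. (kdelta \<kappa> i + h * (n$i * n$\<kappa>)) * z $ \<kappa> $ i) = 1 / r"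
  proof -
    \<comment> \<open>I - n n is the projection orthogonal to n, so its pairing with n n is 0 and
      its pairing with I is the trace 1. The sum in \<open>Aform\<close> below is evaluated the same
      way.\<close>
    have "(\<Sum>\<kappa>\<in>UNIV. \<Sum>i\<in>UNIV. (kdelta \<kappa> i + h * (n$i * n$\<kappa>)) * (kdelta \<kappa> i - n $ \<kappa> * n $ i)) = 1"
      unfolding sum_2 using n by (simp add: kdelta_def) algebra
    then show ?thesis
      unfolding z by (simp add: sum_divide_distrib[symmetric])
  qed
  have A: "Avec p n z $ l $ j = (2 * kdelta l j + (h - 1) * (n $ l * n $ j)) / r" for l j
    unfolding Avec_component coef S unfolding z using r by (simp add: field_simps)
  have Aform: "Aform p n z z = 2 * r powr - 2"
  proof -
    have "(\<Sum>l\<in>UNIV. \<Sum>j\<in>UNIV. (2 * kdelta l j + (h - 1) * (n $ l * n $ j)) * (kdelta l j - n $ l * n $ j)) = 2"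
      unfolding sum_2 using n by (simp add: kdelta_def) algebra
    then have "mdot (Avec p n z) z = 2 / r\<^sup>2"
      unfolding mdot_def A z by (simp add: sum_divide_distrib[symmetric] power2_eq_square)
    then show ?thesis
      using r by (simp add: Aform_eq_mdot powr_minus divide_inverse powr_numeral)
  qed
  have "(norm z)\<^sup>2 = 1 / r\<^sup>2"
  proof -
    have "(\<Sum>l\<in>UNIV. \<Sum>j\<in>UNIV. (kdelta l j - n $ l * n $ j) * (kdelta l j - n $ l * n $ j)) = 1"
      unfolding sum_2 using n by (simp add: kdelta_def) algebra
    then show ?thesis
      unfolding power2_norm_eq_inner inner_vec_def z inner_real_def
      by (simp add: sum_divide_distrib[symmetric] power2_eq_square)
  qed
  then have gz: "g ((norm z)\<^sup>2) = 0"
    using r by (intro g) (simp add: power_le_one)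
  have "(m_g p g * (2 * r powr - 2)) powr ((p - 2) / 2) =
      (2 * m_g p g) powr ((p - 2) / 2) * r powr (2 - p)"
  proof -
    have "(m_g p g * (2 * r powr - 2)) powr ((p - 2) / 2) = ((2 * m_g p g) * r powr - 2) powr ((p - 2) / 2)"
      by (simp add: mult_ac)
    also \<comment> \<open>powr is multiplicative on all reals, so the sign of m_g is irrelevant\<close>
    have "\<dots> = (2 * m_g p g) powr ((p - 2) / 2) * (r powr - 2) powr ((p - 2) / 2)"
      by (rule powr_mult)
    also have "(r powr - 2) powr ((p - 2) / 2) = r powr (2 - p)"
      unfolding powr_powr by (rule arg_cong[of _ _ "(powr) r"]) (simp add: field_simps)
    finally show ?thesis .
  qed
  then have "afield p g n z $ l $ j = (2 * m_g p g) powr ((p - 2) / 2) * (r powr (2 - p) *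
      ((2 * kdelta l j + (h - 1) * (n $ l * n $ j)) / r))"
    unfolding afield_def gz Aform by (simp add: A)
  also have "r powr (2 - p) * ((2 * kdelta l j + (h - 1) * (n $ l * n $ j)) / r) =
     r powr (1 - p) * (2 * kdelta l j + (h - 1) * (n $ l * n $ j))"
  proof -
    have "r powr (2 - p) = r * r powr (1 - p)"
      using r powr_mult_base[of r "1 - p"] by simp
    then show ?thesis using r by simp
  qed
  also have "\<dots> = 2 * flux p l j x"
  proof -
    have "r powr (1 - p) = r * r * r powr (- 1 - p)"
      using r powr_mult_base[of r "- p"] powr_mult_base[of r "- 1 - p"] by (simp add: mult.assoc)
    \<comment> \<open>This is where the coefficient in A matches the one in
      \<open>flux\<close>.\<close>
    moreover have "h - 1 = 2 * ((p - 1) / (2 - p))"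
      using p by (simp add: h_def field_simps)
    ultimately show ?thesis
      unfolding flux_def r_def[symmetric] xn by (simp add: algebra_simps)
  qed
  finally show ?thesis
    unfolding n_def z_def r_def by (simp add: mult_ac)
qed

section \<open>Size and regularity of the gradient and the flux\<close>

lemma sgn_component: "(inverse (norm x) *\<^sub>R x) $ k = x $ k * norm (x::real^'n::finite) powr - 1"
  by (simp add: powr_minus_divide divide_inverse)

lemma measurable_sgn: "(\<lambda>x::real^2. inverse (norm x) *\<^sub>R x) \<in> borel_measurable borel"
  by measurable

lemma measurable_sgn_grad: "sgn_grad \<in> borel_measurable borel"
  unfolding sgn_grad_def[abs_def] by (intro borel_measurable_vec_lambda) measurable

text \<open>Off the origin r times the matrix is a rank-one orthogonal projection, of Euclidean norm
  1; at the origin both sides are 0 by the convention for powers.\<close>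

lemma norm_sgn_grad: "norm (sgn_grad x) = norm x powr - 1"
proof (cases "x = 0")
  case True
  then have "sgn_grad x = 0" by (simp add: sgn_grad_def vec_eq_iff)
  with True show ?thesis by simp
next
  case False
  then have r: "norm x > 0" by simp
  have "(norm (sgn_grad x))\<^sup>2 = (inverse (norm x))\<^sup>2"
  proof -
    have e: "norm x powr - 1 = (norm x)\<^sup>2 * inverse (norm x) ^ 3" "norm x powr - 3 = inverse (norm x) ^ 3"
      using r by (simp_all add: powr_minus powr_numeral field_simps power2_eq_square power3_eq_cube)
    have "(norm (sgn_grad x))\<^sup>2 = (((x $ 1)\<^sup>2 + (x $ 2)\<^sup>2) * inverse (norm x) ^ 3)\<^sup>2"
      unfolding power2_norm_eq_inner inner_vec_def sum_2 sgn_grad_def e power2_norm_2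
      by (simp add: kdelta_def power2_eq_square algebra_simps)
    also have "\<dots> = (inverse (norm x))\<^sup>2"
      unfolding power2_norm_2[symmetric] using r by (simp add: field_simps power2_eq_square power3_eq_cube)
    finally show ?thesis .
  qed
  then have "norm (sgn_grad x) = inverse (norm x)"
    by (rule power2_eq_imp_eq) auto
  then show ?thesis using r by (simp add: powr_minus)
qed

text \<open>The flux has the milder size r^(1-p); it is bounded by r^(-p) to share the exponent of
  its derivative.\<close>

lemma abs_flux_le:
  assumes p: "1 < p" "p < 2" and x: "norm x < 1"
  shows "\<bar>flux p l j x\<bar> \<le> (1 + 1 / (2 - p)) * norm x powr - p"
proof -
  have b: "0 \<le> (p - 1) / (2 - p)" "(p - 1) / (2 - p) \<le> 1 / (2 - p)"
    using p by (auto intro: divide_right_mono)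
  have "norm x powr (1 - p) = norm x * norm x powr - p"
    by (simp add: powr_mult_base)
  also have "\<dots> \<le> norm x powr - p"
    using x by (intro mult_left_le_one_le) auto
  finally have 0: "norm x powr (1 - p) \<le> norm x powr - p" .
  have 1: "\<bar>kdelta l j * norm x powr (1 - p)\<bar> \<le> norm x powr - p"
    using 0 by (simp add: kdelta_def)
  have 2: "\<bar>x $ l * x $ j * norm x powr (- 1 - p)\<bar> \<le> norm x powr - p"
  proof (rule component_mult_norm_powr_le)
    show "\<bar>x $ l\<bar> * norm x powr (- 1 - p + 1) \<le> norm x powr - p"
      using mult_left_le_one_le[of "norm x powr - p" "\<bar>x $ l\<bar>"] component_le_norm_cart[of x l] x
      by simp
  qed
  have "\<bar>flux p l j x\<bar> \<le> norm x powr - p + 1 / (2 - p) * norm x powr - p"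
    unfolding flux_def
    by (rule order.trans[OF abs_triangle_ineq], rule add_mono[OF 1])
      (use b 2 in \<open>auto simp only: abs_mult[of "_ / _"] abs_of_nonneg intro!: mult_mono\<close>)
  then show ?thesis by (simp add: algebra_simps)
qed

text \<open>The 5 is 2 + 3: two linear terms from differentiating x_l x_j, and |-1-p| <= 3 from
  differentiating the power.\<close>

lemma abs_flux_deriv_le:
  assumes p: "1 < p" "p < 2"
  shows "\<bar>flux_deriv p l j x\<bar> \<le> (1 + 5 / (2 - p)) * norm x powr - p"
proof -
  let ?N = "norm x powr - p"
  have b: "0 \<le> (p - 1) / (2 - p)" "(p - 1) / (2 - p) \<le> 1 / (2 - p)"
    using p by (auto intro: divide_right_mono)
  have lin: "\<bar>c * x $ k * norm x powr (- 1 - p)\<bar> \<le> \<bar>c\<bar> * ?N" for c k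
    by (rule component_mult_norm_powr_le) simp
  have 1: "\<bar>kdelta l j * ((1 - p) * x $ j * norm x powr (- 1 - p))\<bar> \<le> ?N"
    using lin[of "1 - p" j] mult_right_mono[of "\<bar>1 - p\<bar>" 1 ?N] p by (auto simp: kdelta_def)
  have 2: "\<bar>(kdelta l j * x $ j + x $ l) * norm x powr (- 1 - p)\<bar> \<le> 2 * ?N"
    using lin[of 1 l] lin[of "kdelta l j" j] by (auto simp: kdelta_def distrib_right)
  have 3: "\<bar>x $ l * x $ j * ((- 1 - p) * x $ j * norm x powr (- 3 - p))\<bar> \<le> 3 * ?N"
  proof -
    \<comment> \<open>Three coordinates are traded one after another, raising the exponent from -3-p
      to -p.\<close>
    have "\<bar>((- 1 - p) * x $ j * x $ l) * x $ j * norm x powr (- 3 - p)\<bar> \<le> 3 * ?N"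
    proof (rule component_mult_norm_powr_le)
      have "\<bar>(- 1 - p) * x $ j * x $ l * norm x powr (- 3 - p + 1)\<bar> \<le> 3 * ?N"
      proof (rule component_mult_norm_powr_le)
        have "\<bar>(- 1 - p) * x $ j * norm x powr (- 3 - p + 1 + 1)\<bar> \<le> 3 * ?N"
          using lin[of "- 1 - p" j] mult_right_mono[of "\<bar>- 1 - p\<bar>" 3 ?N] p by simp
        then show "\<bar>(- 1 - p) * x $ j\<bar> * norm x powr (- 3 - p + 1 + 1) \<le> 3 * ?N"
          by (simp add: abs_mult)
      qed
      then show "\<bar>(- 1 - p) * x $ j * x $ l\<bar> * norm x powr (- 3 - p + 1) \<le> 3 * ?N"
        by (simp add: abs_mult)
    qed
    then show ?thesis by (simp add: mult_ac)
  qed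
  have "\<bar>(kdelta l j * x $ j + x $ l) * norm x powr (- 1 - p) + x $ l * x $ j * ((- 1 - p) * x $ j * norm x powr (- 3 - p))\<bar> \<le> 5 * ?N"
    using 2 3 by linarith
  then have "\<bar>flux_deriv p l j x\<bar> \<le> ?N + 1 / (2 - p) * (5 * ?N)"
    unfolding flux_deriv_def
    by (intro order.trans[OF abs_triangle_ineq] add_mono[OF 1])
      (use b in \<open>auto simp only: abs_mult[of "_ / _"] abs_of_nonneg intro!: mult_mono\<close>)
  then show ?thesis by (simp add: algebra_simps)
qed

lemma continuous_flux:
  assumes "p \<noteq> 2"
  shows "continuous_on (- {0}) (flux p l j)" "continuous_on (- {0}) (flux_deriv p l j)"
  using assms unfolding flux_def[abs_def] flux_deriv_def[abs_def] by (auto intro!: continuous_intros)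

lemma measurable_flux: "flux p l j \<in> borel_measurable borel" "flux_deriv p l j \<in> borel_measurable borel"
  unfolding flux_def[abs_def] flux_deriv_def[abs_def] by measurable

lemma set_integrable_one_ball: "set_integrable lborel (ball a r) (\<lambda>x::'a::euclidean_space. 1::real)"
  using emeasure_lborel_ball_finite[of a r] by (simp add: set_integrable_def integrable_indicator_iff)

lemma norm_sgn_le_1: "norm (inverse (norm x) *\<^sub>R x) \<le> 1"
  by (cases "x = 0") simp_all

lemma Lp_on_sgn:
  assumes "0 < q"
  shows "Lp_on q (ball 0 1) (\<lambda>x::real^2. inverse (norm x) *\<^sub>R x)"
proof -
  have m: "(\<lambda>x::real^2. norm (inverse (norm x) *\<^sub>R x) powr q) \<in> borel_measurable borel"
    by measurable
  have b: "norm (norm (inverse (norm x) *\<^sub>R x) powr q) \<le> norm (1::real)" for x :: "real^2"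
    using powr_le1[OF less_imp_le[OF assms], of "norm (inverse (norm x) *\<^sub>R x)"] norm_sgn_le_1[of x]
    by (simp only: real_norm_def abs_of_nonneg[OF powr_ge_zero] abs_norm_cancel abs_one)
  have "set_integrable lborel (ball 0 1) (\<lambda>x::real^2. norm (inverse (norm x) *\<^sub>R x) powr q)"
    by (intro set_integrable_bound[OF set_integrable_one_ball] set_borel_measurableI AE_I2 impI m b borel_open[OF open_ball])
  then show ?thesis
    unfolding Lp_on_def using measurable_sgn by (auto intro!: set_borel_measurableI)
qed

lemma Lp_on_sgn_grad:
  assumes "0 < q" "q < 2"
  shows "Lp_on q (ball 0 1) sgn_grad"
  unfolding Lp_on_def norm_sgn_grad powr_powr
  using set_integrable_norm_powr[of q] assms measurable_sgn_grad by (auto intro!: set_borel_measurableI)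

section \<open>Weak identities for x/|x| and for the flux\<close>

lemma weak_grad_sgn:
  "weak_grad (ball 0 1) (\<lambda>x::real^2. inverse (norm x) *\<^sub>R x) sgn_grad"
proof -
  have ibp: "(LINT x:ball 0 1|lborel. (inverse (norm x) *\<^sub>R x) $ k * partial i \<phi> x) = - (LINT x:ball 0 1|lborel. sgn_grad x $ k $ i * \<phi> x)"
    if \<phi>: "test_fun (ball 0 1) (\<lambda>x::real^2. (\<chi> j::1. \<phi> x))" for \<phi> k i
    unfolding sgn_component
  \<comment> \<open>q = 1 is the order of the singularity of \<open>sgn_grad\<close>; the bounded
    function x_k/r obeys the same bound because 1/r is at least 1 in the disc.\<close>
  proof (rule integration_by_parts_punctured(3)[where q = 1 and C = 2])
    show "(\<lambda>x::real^2. x $ k * norm x powr - 1) \<in> borel_measurable borel" by measurable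
    show "(\<lambda>x. sgn_grad x $ k $ i) \<in> borel_measurable borel"
      unfolding sgn_grad_def by simp
    show "continuous_on (- {0}) (\<lambda>x::real^2. x $ k * norm x powr - 1)"
      "continuous_on (- {0}) (\<lambda>x. sgn_grad x $ k $ i)"
      unfolding sgn_grad_def by (auto intro!: continuous_intros)
    show "((\<lambda>t. (x + t *\<^sub>R axis i 1) $ k * norm (x + t *\<^sub>R axis i 1) powr - 1) has_real_derivative sgn_grad x $ k $ i) (at 0)"
      if "x \<noteq> 0" for x
      by (rule DERIV_cong, rule DERIV_mult[OF DERIV_component_along_axis DERIV_norm_powr_along_axis[OF that]])
        (simp add: sgn_grad_def algebra_simps)
    fix x :: "real^2" assume "x \<in> ball 0 1" "x \<noteq> 0"
    then have x: "norm x powr - 1 \<ge> 1"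
      by (simp add: powr_minus one_le_inverse)
    have "\<bar>1 * x $ k * norm x powr - 1\<bar> \<le> 1"
      by (rule component_mult_norm_powr_le) simp
    with x show "\<bar>x $ k * norm x powr - 1\<bar> \<le> 2 * norm x powr - 1" by simp
    have "\<bar>sgn_grad x $ k $ i\<bar> \<le> norm (sgn_grad x)"
      by (rule order.trans[OF component_le_norm_cart Finite_Cartesian_Product.norm_nth_le])
    with x show "\<bar>sgn_grad x $ k $ i\<bar> \<le> 2 * norm x powr - 1"
      by (simp add: norm_sgn_grad)
  qed (use \<phi> in auto)
  show ?thesis
    unfolding weak_grad_def using Lp_on_sgn[of 1] Lp_on_sgn_grad[of 1] ibp by auto
qed

lemma flux_weakly_divergence_free:
  fixes \<phi> :: "real^2 \<Rightarrow> real"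
  assumes p: "1 < p" "p < 2" and \<phi>: "test_fun (ball 0 1) (\<lambda>x. (\<chi> j::1. \<phi> x))"
  shows "set_integrable lborel (ball 0 1) (\<lambda>x. flux p l j x * partial j \<phi> x)"
    and "(\<Sum>j\<in>UNIV. LINT x:ball 0 1|lborel. flux p l j x * partial j \<phi> x) = 0"
proof -
  let ?C = "1 + 5 / (2 - p)"
  \<comment> \<open>The bound for the flux is enlarged to the constant of its derivative, as one C
    must serve both.\<close>
  have F: "\<bar>flux p l j x\<bar> \<le> ?C * norm x powr - p" if "x \<in> ball 0 1" for j x
    using that p by (intro order.trans[OF abs_flux_le mult_right_mono]) (auto intro!: divide_right_mono)
  note ibp = integration_by_parts_punctured[OF _ p(2) measurable_flux continuous_flux[OF less_imp_neq[OF p(2)]] DERIV_flux F abs_flux_deriv_le[OF p] \<phi>]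
  show "set_integrable lborel (ball 0 1) (\<lambda>x. flux p l j x * partial j \<phi> x)"
    using p by (intro ibp(1)) auto
  have "(\<Sum>j\<in>UNIV. LINT x:ball 0 1|lborel. flux p l j x * partial j \<phi> x) =
      - (\<Sum>j\<in>UNIV. LINT x:ball 0 1|lborel. flux_deriv p l j x * \<phi> x)"
    unfolding sum_negf[symmetric] using p by (intro sum.cong refl ibp(3)) auto
  also have "(\<Sum>j\<in>UNIV. LINT x:ball 0 1|lborel. flux_deriv p l j x * \<phi> x) =
      (LINT x:ball 0 1|lborel. (\<Sum>j\<in>UNIV. flux_deriv p l j x) * \<phi> x)"
    unfolding sum_2 distrib_right using p by (intro set_integral_add(2)[symmetric] ibp(2)) auto
  also have "\<dots> = 0"
    unfolding set_lebesgue_integral_def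
    by (rule integral_eq_zero_AE, rule eventually_mono[OF AE_lborel_singleton[of 0]])
      (simp add: flux_divergence_free[OF p(2)])
  finally show "(\<Sum>j\<in>UNIV. LINT x:ball 0 1|lborel. flux p l j x * partial j \<phi> x) = 0"
    by simp
qed

section \<open>Passage to vector-valued test functions and to an arbitrary weak gradient\<close>

lemma test_fun_component:
  fixes \<phi> :: "real^'n::finite \<Rightarrow> real^'m::finite"
  assumes "test_fun U \<phi>"
  shows "test_fun U (\<lambda>x. (\<chi> j::1. \<phi> x $ k))"
proof -
  have sub: "{x. \<phi> x $ k \<noteq> 0} \<subseteq> {x. \<phi> x \<noteq> 0}" by auto
  then have "bounded {x. \<phi> x $ k \<noteq> 0}"
    using assms bounded_subset by (auto simp: test_fun_def)
  with closure_mono[OF sub] assms show ?thesis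
    by (auto simp: test_fun_scalar_iff test_fun_def)
qed

text \<open>The integrand with an arbitrary \<open>Du\<close> is compared with the explicit one only
  almost everywhere, so its measurability has to be known separately.\<close>

lemma measurable_integrand:
  fixes v :: "real^2 \<Rightarrow> real^2" and W G :: "real^2 \<Rightarrow> real^2^2"
  assumes g: "g \<in> borel_measurable borel" and v: "v \<in> borel_measurable borel"
    and W: "W \<in> borel_measurable borel" and G: "\<And>l j. (\<lambda>x. G x $ l $ j) \<in> borel_measurable borel"
  shows "(\<lambda>x. mdot (afield p g (v x) (W x)) (G x)) \<in> borel_measurable borel"
proof -
  note [measurable] = g v W G
  have [measurable]: "(\<lambda>x. W x $ k $ i) \<in> borel_measurable borel" for k i
  proof (rule measurable_compose[OF W])
    show "(\<lambda>z::real^2^2. z $ k $ i) \<in> borel_measurable borel"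
      by (intro borel_measurable_continuous_onI continuous_intros)
  qed
  have [measurable]: "(\<lambda>x. v x $ k) \<in> borel_measurable borel" for k
    by (rule measurable_compose[OF v borel_measurable_nth])
  show ?thesis
    unfolding mdot_def afield_def Aform_def Avec_def Acoef_def
    by simp
qed

theorem theorem3p5:
  fixes p :: real and g :: "real \<Rightarrow> real"
  assumes p: "1 < p" "p < 2"
    and g_range: "\<And>s. 0 \<le> g s \<and> g s \<le> 1"
    and g_symm: "\<And>s. g (- s) = g s"
    and g_smooth: "smooth_real g"
    and g_lower: "\<And>s. indicator {0::real} s \<le> g s"
    and g_upper: "\<And>s. g s \<le> indicator {-1<..<1::real} s"
  defines "u \<equiv> (\<lambda>x::real^2. inverse (norm x) *\<^sub>R x)"
  shows "W1p p (ball 0 1) u \<and> Linf_on (ball 0 1) u \<and>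
    (\<forall>Du. weak_grad (ball 0 1) u Du \<longrightarrow>
       (\<forall>\<phi>::real^2 \<Rightarrow> real^2. test_fun (ball 0 1) \<phi> \<longrightarrow>
          set_integrable lborel (ball 0 1) (\<lambda>x. mdot (afield p g (u x) (Du x)) (grad \<phi> x)) \<and>
          (LINT x:ball 0 1|lborel. mdot (afield p g (u x) (Du x)) (grad \<phi> x)) = 0))"
proof (intro conjI allI impI)
  have u_le: "norm (u x) \<le> 1" for x unfolding u_def by (rule norm_sgn_le_1)
  have u_meas: "u \<in> borel_measurable borel"
    unfolding u_def by (rule measurable_sgn)
  have wg: "weak_grad (ball 0 1) u sgn_grad"
    unfolding u_def by (rule weak_grad_sgn)
  show "Linf_on (ball 0 1) u"
    unfolding Linf_on_def using u_le u_meas by (auto intro!: set_borel_measurableI)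
  show "W1p p (ball 0 1) u"
    using wg Lp_on_sgn[of p] Lp_on_sgn_grad[of p] p unfolding W1p_def u_def by auto
  have g_zero: "g s = 0" if "s \<ge> 1" for s
    using g_range[of s] g_upper[of s] that by simp
  have "\<And>x. g differentiable (at x)"
    using g_smooth[unfolded smooth_real_def, rule_format, of 0] by simp
  then have g_meas: "g \<in> borel_measurable borel"
    by (intro borel_measurable_continuous_onI differentiable_imp_continuous_on)
      (simp add: differentiable_on_def)
  fix Du and \<phi> :: "real^2 \<Rightarrow> real^2"
  assume Du: "weak_grad (ball 0 1) u Du" and \<phi>: "test_fun (ball 0 1) \<phi>"
  let ?f = "\<lambda>x. indicator (ball 0 1) x *\<^sub>R mdot (afield p g (u x) (Du x)) (grad \<phi> x)"
  define K where "K = 2 * (2 * m_g p g) powr ((p - 2) / 2)"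
  let ?h = "\<lambda>x. K * (\<Sum>l\<in>UNIV. \<Sum>j\<in>UNIV. flux p l j x * partial j (\<lambda>y. \<phi> y $ l) x)"
  let ?f' = "\<lambda>x. indicator (ball 0 1) x *\<^sub>R ?h x"
  note \<phi>' = test_fun_component[OF \<phi>]
  note flux = flux_weakly_divergence_free[OF p \<phi>']
  have h: "set_integrable lborel (ball 0 1) ?h"
    unfolding sum_2 by (intro set_integrable_mult_right set_integral_add(1) flux(1))
  have h0: "(LINT x:ball 0 1|lborel. ?h x) = 0"
    using flux(2)[of 1] flux(2)[of 2]
    unfolding sum_2 set_integral_mult_right
    by (simp add: set_integral_add flux(1))
  have partial_meas: "partial j (\<lambda>y. \<phi> y $ l) \<in> borel_measurable borel" for j l
    using test_fun_facts(2)[OF \<phi>'] by (rule borel_measurable_continuous_onI)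
  \<comment> \<open>Uniqueness enters here: off a null set, enlarged by the origin,
    \<open>Du\<close> is \<open>sgn_grad\<close> and the explicit formula applies.\<close>
  have ae: "AE x in lborel. ?f x = ?f' x"
    using weak_grad_unique[OF open_ball Du wg] AE_lborel_singleton[of 0]
  proof eventually_elim
    case (elim x)
    show ?case
    proof (cases "x \<in> ball 0 1")
      case True
      then have "afield p g (u x) (Du x) $ l $ j = K * flux p l j x" for l j
        using elim afield_sgn_grad[OF p, of x g] g_zero by (simp add: u_def K_def)
      then show ?thesis
        by (simp add: mdot_def grad_def sum_distrib_left mult_ac)
    qed simp
  qed
  have f_meas: "?f \<in> borel_measurable lborel"
  proof -
    \<comment> \<open>\<open>Du\<close> is known to be measurable only after multiplication by the
      indicator of the disc; the outer indicator makes this replacement invisible.\<close>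
    let ?W = "\<lambda>x. indicator (ball 0 1) x *\<^sub>R Du x"
    have W: "?W \<in> borel_measurable borel"
      using Du by (simp add: weak_grad_def Lp_on_def set_borel_measurable_def)
    have "(\<lambda>x. mdot (afield p g (u x) (?W x)) (grad \<phi> x)) \<in> borel_measurable borel"
      by (rule measurable_integrand[OF g_meas u_meas W]) (simp add: grad_def partial_meas)
    then have "(\<lambda>x. indicator (ball 0 1) x *\<^sub>R mdot (afield p g (u x) (?W x)) (grad \<phi> x)) \<in> borel_measurable lborel"
      by (intro borel_measurable_scaleR borel_measurable_indicator) auto
    moreover have "?f = (\<lambda>x. indicator (ball 0 1) x *\<^sub>R mdot (afield p g (u x) (?W x)) (grad \<phi> x))"
      by (rule ext, rename_tac x, case_tac "x \<in> ball 0 1") simp_all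
    ultimately show ?thesis by simp
  qed
  have f'_meas: "?f' \<in> borel_measurable lborel"
    using h unfolding set_integrable_def by (rule borel_measurable_integrable)
  show "set_integrable lborel (ball 0 1) (\<lambda>x. mdot (afield p g (u x) (Du x)) (grad \<phi> x))"
    using h unfolding set_integrable_def integrable_cong_AE[OF f_meas f'_meas ae] .
  show "(LINT x:ball 0 1|lborel. mdot (afield p g (u x) (Du x)) (grad \<phi> x)) = 0"
    using h0 unfolding set_lebesgue_integral_def integral_cong_AE[OF f_meas f'_meas ae] .
qed

end
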